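(* Let $0<p\leq q<\infty$, let $g_1,\psi_1,g_2,\psi_2$ be nonconstant entire functions, and suppose $V_{(g_1,\psi_1)},V_{(g_2,\psi_2)},J_{(g_1,\psi_1)},J_{(g_2,\psi_2)}$ are bounded operators from $\mathcal{F}_p$ into $\mathcal{F}_q$. Then: (i) $V_{(g_1,\psi_1)}-V_{(g_2,\psi_2)}$ is compact if and only if either both $V_{(g_1,\psi_1)}$ and $V_{(g_2,\psi_2)}$ are compact, or $\psi_1=\psi_2$ and $\lim_{|z|\to\infty}M_{(g_1-g_2,\psi_1)}(z)=0$; (ii) $J_{(g_1,\psi_1)}-J_{(g_2,\psi_2)}$ is compact if and only if either both $J_{(g_1,\psi_1)}$ and $J_{(g_2,\psi_2)}$ are compact, or $\psi_1=\psi_2$ and $\lim_{|z|\to\infty}\widetilde M_{(g_1-g_2,\psi_1)}(z)=0$.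
   Context: $dA$ is Lebesgue area measure on $\mathbb{C}$. For $0<p<\infty$, $\mathcal{F}_p$ is the space of entire $f$ with $\|f\|_p^p=\frac{p}{2\pi}\int_{\mathbb{C}}|f(z)|^pe^{-\frac p2|z|^2}\,dA(z)<\infty$. For entire $g,\psi$: $V_{(g,\psi)}f(z)=\int_0^z f(\psi(w))g'(w)\,dw$, $J_{(g,\psi)}f(z)=\int_0^z f'(\psi(w))g(w)\,dw$, $M_{(g,\psi)}(z)=\frac{|g'(z)|}{1+|z|}e^{\frac12(|\psi(z)|^2-|z|^2)}$ and $\widetilde M_{(g,\psi)}(z)=\frac{|g(z)|(1+|\psi(z)|)}{1+|z|}e^{\frac12(|\psi(z)|^2-|z|^2)}$. *)

theory Defs
  imports "HOL-Complex_Analysis.Complex_Analysis"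
begin

definition fock_integral :: "real \<Rightarrow> (complex \<Rightarrow> complex) \<Rightarrow> ennreal" where
  "fock_integral p f =
     (\<integral>\<^sup>+ z. ennreal (cmod (f z) powr p * exp (-(p/2) * (cmod z)^2)) \<partial>lborel)"

definition fock_in :: "real \<Rightarrow> (complex \<Rightarrow> complex) \<Rightarrow> bool" where
  "fock_in p f \<longleftrightarrow> f holomorphic_on UNIV \<and> fock_integral p f < \<infinity>"

definition fock_norm :: "real \<Rightarrow> (complex \<Rightarrow> complex) \<Rightarrow> real" where
  "fock_norm p f = (p / (2 * pi) * enn2real (fock_integral p f)) powr (1 / p)"

definition fock_bounded_op ::
  "real \<Rightarrow> real \<Rightarrow> ((complex \<Rightarrow> complex) \<Rightarrow> (complex \<Rightarrow> complex)) \<Rightarrow> bool" where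
  "fock_bounded_op p q T \<longleftrightarrow>
     (\<exists>C. \<forall>f. fock_in p f \<longrightarrow> fock_in q (T f) \<and> fock_norm q (T f) \<le> C * fock_norm p f)"

text \<open>Compact operator F_p -> F_q: maps bounded sequences to sequences having a
  subsequence convergent in F_q (F_q is a complete metric space).\<close>
definition fock_compact_op ::
  "real \<Rightarrow> real \<Rightarrow> ((complex \<Rightarrow> complex) \<Rightarrow> (complex \<Rightarrow> complex)) \<Rightarrow> bool" where
  "fock_compact_op p q T \<longleftrightarrow>
     (\<forall>fs :: nat \<Rightarrow> complex \<Rightarrow> complex. (\<forall>n. fock_in p (fs n)) \<and> (\<exists>B. \<forall>n. fock_norm p (fs n) \<le> B) \<longrightarrow>
        (\<exists>r h. strict_mono r \<and> fock_in q h \<and>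
           (\<lambda>n. fock_norm q (\<lambda>z. T (fs (r n)) z - h z)) \<longlonglongrightarrow> 0))"

definition Vop :: "(complex \<Rightarrow> complex) \<Rightarrow> (complex \<Rightarrow> complex) \<Rightarrow> (complex \<Rightarrow> complex) \<Rightarrow> complex \<Rightarrow> complex" where
  "Vop g \<psi> f z = contour_integral (linepath 0 z) (\<lambda>w. f (\<psi> w) * deriv g w)"

definition Jop :: "(complex \<Rightarrow> complex) \<Rightarrow> (complex \<Rightarrow> complex) \<Rightarrow> (complex \<Rightarrow> complex) \<Rightarrow> complex \<Rightarrow> complex" where
  "Jop g \<psi> f z = contour_integral (linepath 0 z) (\<lambda>w. deriv f (\<psi> w) * g w)"

definition Mfun :: "(complex \<Rightarrow> complex) \<Rightarrow> (complex \<Rightarrow> complex) \<Rightarrow> complex \<Rightarrow> real" where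
  "Mfun g \<psi> z = cmod (deriv g z) / (1 + cmod z) * exp ((cmod (\<psi> z)^2 - cmod z^2) / 2)"

definition Mtfun :: "(complex \<Rightarrow> complex) \<Rightarrow> (complex \<Rightarrow> complex) \<Rightarrow> complex \<Rightarrow> real" where
  "Mtfun g \<psi> z = cmod (g z) * (1 + cmod (\<psi> z)) / (1 + cmod z) * exp ((cmod (\<psi> z)^2 - cmod z^2) / 2)"

definition nonconstant :: "(complex \<Rightarrow> complex) \<Rightarrow> bool" where
  "nonconstant f \<longleftrightarrow> \<not> (\<exists>c. \<forall>z. f z = c)"

end

theory Submission
  imports Defs "HOL-Real_Asymp.Real_Asymp"
begin

text \<open>
  Both operators have the form \<open>T f z = \<integral>\<^sub>0\<^sup>z (D\<^sup>i f)(\<psi> w) m(w) dw\<close> with \<open>i = 0\<close>, \<open>m = g'\<close> for \<open>V\<close> and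
  \<open>i = 1\<close>, \<open>m = g\<close> for \<open>J\<close>, and both symbols are
  \<open>N(z) = |m z| (1 + |\<psi> z|)\<^sup>i / (1 + |z|) * exp ((|\<psi> z|\<^sup>2 - |z|\<^sup>2) / 2)\<close>.

  Testing boundedness of \<open>V\<close> on normalised reproducing kernels bounds its symbol, and the maximum
  principle then forces \<open>\<psi>\<close> to be affine.

  Sufficiency: the norm of \<open>F\<close> with \<open>F 0 = 0\<close> is controlled by the weighted norm of \<open>F'\<close>, because
  \<open>|F z| exp (- |z|\<^sup>2 / 2)\<close> is at most a constant times the supremum of
  \<open>E(tz) exp (- |z - tz|\<^sup>2 / 4)\<close> over \<open>0 \<le> t \<le> 1\<close>, where
  \<open>E(w) = |F' w| / (1 + |w|) * exp (- |w|\<^sup>2 / 2)\<close>; by the local sub-mean value property this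
  supremum is dominated by a convolution of \<open>E\<^sup>q\<close> with a Gaussian. Hence \<open>N \<rightarrow> 0\<close> together
  with Montel's theorem yields compactness.

  Necessity: if \<open>\<psi>\<^sub>1 \<noteq> \<psi>\<^sub>2\<close> then \<open>|\<psi>\<^sub>1 - \<psi>\<^sub>2|\<close> is bounded below near infinity, so a reproducing kernel
  at \<open>\<psi>\<^sub>1 z\<close> can be multiplied by an affine factor with bounded coefficients so that the second operator
  contributes nothing to the derivative at \<open>z\<close>. The images of these test functions tend to zero in
  norm, which forces \<open>N\<^sub>1 \<rightarrow> 0\<close>; the roles of the two operators are symmetric.
\<close>

subsection \<open>Local estimates\<close>

text \<open>For \<open>i = 0\<close> this is the integrand of \<open>fock_integral\<close>. For
  \<open>i = 1\<close> the derivative is divided by \<open>1 + cmod z\<close>, which offsets its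
  extra growth on a Fock space, so both orders are controlled by one integral. The index lets
  \<open>Vop\<close> and \<open>Jop\<close> be treated together.\<close>

definition fock_wdens :: "nat \<Rightarrow> real \<Rightarrow> (complex \<Rightarrow> complex) \<Rightarrow> complex \<Rightarrow> real" where
  "fock_wdens i p f z =
     (cmod ((deriv ^^ i) f z) / (1 + cmod z) ^ i) powr p * exp (-(p/2) * (cmod z)\<^sup>2)"

lemma fock_wdens_nonneg [simp]: "0 \<le> fock_wdens i p f z"
  by (simp add: fock_wdens_def)

lemma fock_integral_eq: "fock_integral p f = (\<integral>\<^sup>+ z. ennreal (fock_wdens 0 p f z) \<partial>lborel)"
  by (simp add: fock_integral_def fock_wdens_def)

lemma holomorphic_deriv_funpow:
  "f holomorphic_on UNIV \<Longrightarrow> (deriv ^^ i) f holomorphic_on UNIV"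
  by (simp add: holomorphic_higher_deriv)

lemma holomorphic_borel_measurable:
  "f holomorphic_on UNIV \<Longrightarrow> f \<in> borel_measurable borel"
  by (intro borel_measurable_continuous_onI holomorphic_on_imp_continuous_on)

lemma fock_wdens_measurable:
  assumes "f holomorphic_on UNIV"
  shows "(\<lambda>z. fock_wdens i p f z) \<in> borel_measurable borel"
proof -
  have [measurable]: "(deriv ^^ i) f \<in> borel_measurable borel"
    using assms holomorphic_borel_measurable holomorphic_deriv_funpow by blast
  show ?thesis unfolding fock_wdens_def by measurable
qed

lemma sets_borel_ball [measurable]: "ball (z::complex) r \<in> sets borel"
  by simp

lemma nn_integral_lborel_translate:
  fixes g :: "complex \<Rightarrow> ennreal"
  assumes [measurable]: "g \<in> borel_measurable borel"
  shows "(\<integral>\<^sup>+ u. g (z + u) \<partial>lborel) = (\<integral>\<^sup>+ w. g w \<partial>lborel)"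
proof -
  have "(\<integral>\<^sup>+ w. g w \<partial>lborel) = (\<integral>\<^sup>+ w. g w \<partial>(distr lborel borel ((+) z)))"
    by (simp add: lborel_distr_plus)
  also have "\<dots> = (\<integral>\<^sup>+ u. g (z + u) \<partial>lborel)"
    by (subst nn_integral_distr) auto
  finally show ?thesis by simp
qed

lemma emeasure_ball_complex: "0 \<le> r \<Longrightarrow> emeasure lborel (ball (c::complex) r) = ennreal (pi * r\<^sup>2)"
  by (simp add: emeasure_ball unit_ball_vol_2)

lemma entire_continuous_on: "f holomorphic_on UNIV \<Longrightarrow> continuous_on S f"
  using holomorphic_on_imp_continuous_on continuous_on_subset by blast

lemma entire_Cauchy_inequality:
  assumes "f holomorphic_on UNIV" "0 < r" "\<And>x. cmod (z - x) = r \<Longrightarrow> cmod (f x) \<le> B"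
  shows "cmod ((deriv ^^ n) f z) \<le> fact n * B / r ^ n"
  using assms by (intro Cauchy_inequality entire_continuous_on)
    (auto intro: holomorphic_on_subset)

lemma entire_deriv_bound:
  assumes "f holomorphic_on UNIV" "0 < r" "\<And>x. cmod (z - x) = r \<Longrightarrow> cmod (f x) \<le> B"
  shows "cmod (deriv f z) \<le> B / r"
  using entire_Cauchy_inequality[of f r z B 1, OF assms] by simp

text \<open>At a maximum point of \<open>(1 - |z|) powr (2/p) * |f z|\<close> Cauchy's estimate keeps \<open>|f|\<close> above half
  its value on a disc of radius proportional to \<open>1 - |z|\<close>; this gives the sub-mean value
  property, up to a constant, for every exponent \<open>p > 0\<close>.\<close>
lemma powr_le_nn_integral_ball:
  assumes p: "0 < p"
  shows "\<exists>C>0. \<forall>f u. f holomorphic_on UNIV \<longrightarrow> cmod u \<le> 1/2 \<longrightarrow>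
     ennreal (cmod (f u) powr p) \<le>
       ennreal C * (\<integral>\<^sup>+ w. ennreal (cmod (f w) powr p) * indicator (ball 0 1) w \<partial>lborel)"
proof -
  \<comment> \<open>Halving \<open>1 - cmod z\<close> lowers the weight
    \<open>(1 - cmod z) powr (2/p)\<close> by exactly the factor \<open>k\<close>.\<close>
  define k where "k = (2::real) powr (2/p)"
  have k: "1 \<le> k" unfolding k_def using p by (simp add: ge_one_powr_ge_zero)
  \<comment> \<open>The 256 is 4 times 64: the 4 comes from \<open>cmod u \<le> 1/2\<close> in
    \<open>key\<close>, the 64 and the square of \<open>k\<close> from the area of a disc of radius
    \<open>d / (8 * k)\<close>. The factor \<open>2 powr p\<close> comes from the lower bound
    \<open>A / 2\<close>.\<close>
  define C where "C = 256 * 2 powr p * k\<^sup>2 / pi"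
  have C: "0 < C" using k by (simp add: C_def)
  have "ennreal (cmod (f u) powr p) \<le>
       ennreal C * (\<integral>\<^sup>+ w. ennreal (cmod (f w) powr p) * indicator (ball 0 1) w \<partial>lborel)"
    if f: "f holomorphic_on UNIV" and u: "cmod u \<le> 1/2" for f u
  proof -
    note fc = entire_continuous_on[OF f]
    \<comment> \<open>With the exponent \<open>2/p\<close>, the p-th power of \<open>W\<close>
      carries the square of \<open>1 - cmod z\<close>, which matches the area of a disc of radius
      proportional to \<open>1 - cmod z\<close>.\<close>
    define W where "W = (\<lambda>z. (1 - cmod z) powr (2/p) * cmod (f z))"
    have "continuous_on (cball 0 1) W"
      unfolding W_def using p by (intro continuous_intros continuous_on_powr' fc) auto
    then obtain z0 where z0: "z0 \<in> cball 0 1" and max: "\<And>z. z \<in> cball 0 1 \<Longrightarrow> W z \<le> W z0"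
      using continuous_attains_sup[of "cball 0 1" W] by (metis cball_eq_empty compact_cball linorder_not_less zero_le_one)
    define d A where "d = 1 - cmod z0" and "A = cmod (f z0)"
    have d0: "0 \<le> d" using z0 by (simp add: d_def)
    have Wz0: "W z0 = d powr (2/p) * A" by (simp add: W_def d_def A_def)
    have Wp: "W z powr p = (1 - cmod z) powr 2 * cmod (f z) powr p" if "cmod z \<le> 1" for z
      using that p by (simp add: W_def powr_mult powr_powr)
    have "W u powr p \<le> W z0 powr p"
      using max[of u] u p by (intro powr_mono2) (auto simp: W_def)
    moreover have "(1/2)\<^sup>2 * cmod (f u) powr p \<le> W u powr p"
      unfolding Wp[OF order_trans[OF u]] using u
      by (simp add: Wp, intro mult_right_mono) (auto simp: powr_realpow' intro: power_mono)
    moreover have "W z0 powr p = d\<^sup>2 * A powr p"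
      using Wp[of z0] z0 d0 by (simp add: d_def A_def)
    ultimately have key: "cmod (f u) powr p \<le> 4 * (d\<^sup>2 * A powr p)"
      by (simp add: power2_eq_square)
    show ?thesis
    proof (cases "d = 0 \<or> A = 0")
      case True
      then have "cmod (f u) powr p \<le> 0" using key by auto
      then show ?thesis by (simp add: ennreal_neg)
    next
      case False
      then have d: "0 < d" and A: "0 < A" using d0 by (auto simp: A_def)
      have fb: "cmod (f w) \<le> k * A" if "w \<in> cball z0 (d/2)" for w
      proof -
        have "cmod w \<le> cmod z0 + d/2" using that norm_triangle_sub[of w z0]
          by (simp add: dist_norm norm_minus_commute)
        then have w: "d/2 \<le> 1 - cmod w" unfolding d_def by (simp add: field_simps)
        have "(d/2) powr (2/p) * cmod (f w) \<le> W w"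
          unfolding W_def using w d p by (intro mult_right_mono powr_mono2) auto
        also have "\<dots> \<le> d powr (2/p) * A"
          using max[of w] w d Wz0 by simp
        also have "d powr (2/p) = (d/2) powr (2/p) * k"
          using d by (simp add: k_def flip: powr_mult)
        finally have "(d/2) powr (2/p) * cmod (f w) \<le> (d/2) powr (2/p) * (k * A)" by (simp only: mult.assoc)
        then show ?thesis using d by (simp add: mult_le_cancel_left)
      qed
      have db: "cmod (deriv f w) \<le> 4 * k * A / d" if "w \<in> cball z0 (d/4)" for w
      proof -
        have "cmod (deriv f w) \<le> k * A / (d/4)"
        proof (rule entire_deriv_bound[OF f])
          fix x assume "cmod (w - x) = d/4"
          then have "x \<in> cball z0 (d/2)"
            using that dist_triangle[of z0 x w] by (simp add: dist_norm)
          then show "cmod (f x) \<le> k * A" by (rule fb)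
        qed (use d in auto)
        then show ?thesis by (simp add: field_simps)
      qed
      \<comment> \<open>The derivative is at most \<open>4 * k * A / d\<close> on
        \<open>cball z0 (d/4)\<close>, so within distance \<open>e\<close> the value of
        \<open>f\<close> moves by at most \<open>A / 2\<close>.\<close>
      define e where "e = d / (8 * k)"
      have e: "0 < e" "e \<le> d/4" using d k by (auto simp: e_def field_simps)
      have low: "A / 2 \<le> cmod (f w)" if "w \<in> ball z0 e" for w
      proof -
        have "cmod (f w - f z0) \<le> (4 * k * A / d) * cmod (w - z0)"
        proof (rule field_differentiable_bound[of "cball z0 (d/4)"])
          show "(f has_field_derivative deriv f x) (at x within cball z0 (d/4))" for x
            using f by (simp add: holomorphic_derivI)
        qed (use that e db in auto)
        also have "\<dots> \<le> (4 * k * A / d) * e"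
          using that A d k by (intro mult_left_mono) (auto simp: dist_norm norm_minus_commute)
        also have "\<dots> = A / 2" using d k by (simp add: e_def)
        finally show ?thesis
          using norm_triangle_sub[of "f z0" "f w"] by (simp add: A_def norm_minus_commute)
      qed
      have sub: "ball z0 e \<subseteq> ball 0 1"
      proof
        fix w assume "w \<in> ball z0 e"
        then have "cmod w < cmod z0 + d/4"
          using e norm_triangle_sub[of w z0] by (simp add: dist_norm norm_minus_commute)
        then show "w \<in> ball 0 1" using d unfolding d_def by (simp add: field_simps)
      qed
      have "ennreal ((A/2) powr p * (pi * e\<^sup>2)) = (\<integral>\<^sup>+ w. ennreal ((A/2) powr p) * indicator (ball z0 e) w \<partial>lborel)"
        using e by (simp add: nn_integral_cmult_indicator emeasure_ball_complex ennreal_mult')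
      also have "\<dots> \<le> (\<integral>\<^sup>+ w. ennreal (cmod (f w) powr p) * indicator (ball 0 1) w \<partial>lborel)"
      proof (rule nn_integral_mono)
        fix w
        show "ennreal ((A/2) powr p) * indicator (ball z0 e) w \<le> ennreal (cmod (f w) powr p) * indicator (ball 0 1) w"
          using low[of w] sub A p by (auto simp: indicator_def intro!: ennreal_leI powr_mono2)
      qed
      finally have I: "ennreal C * ennreal ((A/2) powr p * (pi * e\<^sup>2)) \<le>
         ennreal C * (\<integral>\<^sup>+ w. ennreal (cmod (f w) powr p) * indicator (ball 0 1) w \<partial>lborel)"
        by (intro mult_left_mono) auto
      have "C * ((A/2) powr p * (pi * e\<^sup>2)) = 4 * (d\<^sup>2 * A powr p)"
        using k A by (simp add: C_def e_def powr_divide power_divide power_mult_distrib field_simps)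
      then have "ennreal (cmod (f u) powr p) \<le> ennreal C * ennreal ((A/2) powr p * (pi * e\<^sup>2))"
        using key C by (simp flip: ennreal_mult' add: ennreal_leI)
      then show ?thesis using I by (rule order_trans)
    qed
  qed
  then show ?thesis using C by blast
qed

lemma Re_cnj_mult: "Re (cnj z * u) = ((cmod (z + u))\<^sup>2 - (cmod z)\<^sup>2 - (cmod u)\<^sup>2) / 2"
  unfolding cmod_power2 by (simp add: algebra_simps power2_eq_square)

text \<open>The twisted translate \<open>h u = f (z + u) * exp (- cnj z * u)\<close> moves the
  Gaussian weight to the origin: its p-th power is the density at \<open>z + u\<close> up to a
  constant depending on \<open>z\<close> and a factor bounded on the unit disc, so the unweighted
  estimate applies. For \<open>i = 1\<close>, Cauchy's estimate for \<open>h\<close> is combined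
  with f'(z) = h'(0) + cnj z * h(0), which is where \<open>1 + cmod z\<close> enters.\<close>

lemma fock_wdens_le_nn_integral_ball:
  assumes p: "0 < p"
  shows "\<exists>C>0. \<forall>f z i. f holomorphic_on UNIV \<longrightarrow> i \<le> 1 \<longrightarrow>
     ennreal (fock_wdens i p f z) \<le>
       ennreal C * (\<integral>\<^sup>+ w. ennreal (fock_wdens 0 p f w) * indicator (ball z 1) w \<partial>lborel)"
proof -
  obtain C0 where C0: "0 < C0" and loc: "\<And>f u. f holomorphic_on UNIV \<Longrightarrow> cmod u \<le> 1/2 \<Longrightarrow>
     ennreal (cmod (f u) powr p) \<le>
       ennreal C0 * (\<integral>\<^sup>+ w. ennreal (cmod (f w) powr p) * indicator (ball 0 1) w \<partial>lborel)"
    using powr_le_nn_integral_ball[OF p] by metis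
  define C where "C = 2 powr p * C0 * exp (p/2)"
  have C: "0 < C" using C0 by (simp add: C_def)
  have "ennreal (fock_wdens i p f z) \<le>
       ennreal C * (\<integral>\<^sup>+ w. ennreal (fock_wdens 0 p f w) * indicator (ball z 1) w \<partial>lborel)"
    if f: "f holomorphic_on UNIV" and i: "i \<le> 1" for f z i
  proof -
    define J where "J = (\<integral>\<^sup>+ w. ennreal (fock_wdens 0 p f w) * indicator (ball z 1) w \<partial>lborel)"
    note [measurable] = fock_wdens_measurable[OF f]
    show ?thesis
    proof (cases "J = \<infinity>")
      case True
      then show ?thesis using C by (simp add: J_def[symmetric] ennreal_mult_top)
    next
      case False
      then obtain j where j: "0 \<le> j" "J = ennreal j" by (cases J) auto
      define h where "h = (\<lambda>u. f (z + u) * exp (- cnj z * u))"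
      have hh: "h holomorphic_on UNIV"
      proof -
        have "(\<lambda>u. f (z + u)) holomorphic_on UNIV"
        proof -
          have "(\<lambda>u. z + u) holomorphic_on UNIV" by (intro holomorphic_intros)
          from holomorphic_on_compose_gen[OF this f] show ?thesis by (simp add: o_def)
        qed
        then show ?thesis unfolding h_def by (intro holomorphic_intros)
      qed
      have hp: "cmod (h u) powr p = fock_wdens 0 p f (z + u) * exp (p/2 * (cmod z)\<^sup>2) * exp (p/2 * (cmod u)\<^sup>2)" for u
      proof -
        have "cmod (h u) powr p = cmod (f (z + u)) powr p * exp (- Re (cnj z * u)) powr p"
          by (simp add: h_def norm_mult powr_mult)
        also have "exp (- Re (cnj z * u)) powr p = exp (-(p/2) * (cmod (z+u))\<^sup>2) * exp (p/2 * (cmod z)\<^sup>2) * exp (p/2 * (cmod u)\<^sup>2)"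
          unfolding Re_cnj_mult by (simp add: powr_def field_simps flip: exp_add)
        finally show ?thesis by (simp add: fock_wdens_def)
      qed
      define K where "K = C0 * (exp (p/2) * exp (p/2 * (cmod z)\<^sup>2) * j)"
      have K: "0 \<le> K" using C0 j by (simp add: K_def)
      have "(\<integral>\<^sup>+ u. ennreal (cmod (h u) powr p) * indicator (ball 0 1) u \<partial>lborel)
          \<le> (\<integral>\<^sup>+ u. ennreal (exp (p/2) * exp (p/2 * (cmod z)\<^sup>2)) * (ennreal (fock_wdens 0 p f (z + u)) * indicator (ball z 1) (z + u)) \<partial>lborel)"
      proof (rule nn_integral_mono)
        fix u
        have "cmod (h u) powr p \<le> exp (p/2) * exp (p/2 * (cmod z)\<^sup>2) * fock_wdens 0 p f (z + u)" if "cmod u < 1"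
        proof -
          have "(cmod u)\<^sup>2 \<le> 1" using that by (simp add: power_le_one)
          then have "exp (p/2 * (cmod u)\<^sup>2) \<le> exp (p/2)" using p by simp
          then have "fock_wdens 0 p f (z + u) * exp (p/2 * (cmod z)\<^sup>2) * exp (p/2 * (cmod u)\<^sup>2) \<le> fock_wdens 0 p f (z + u) * exp (p/2 * (cmod z)\<^sup>2) * exp (p/2)"
            by (intro mult_left_mono) auto
          then show ?thesis unfolding hp by (simp add: mult_ac)
        qed
        then show "ennreal (cmod (h u) powr p) * indicator (ball 0 1) u \<le> ennreal (exp (p/2) * exp (p/2 * (cmod z)\<^sup>2)) * (ennreal (fock_wdens 0 p f (z + u)) * indicator (ball z 1) (z + u))"
          by (auto simp: indicator_def dist_norm ennreal_mult'[symmetric] intro!: ennreal_leI)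
      qed
      also have "\<dots> = ennreal (exp (p/2) * exp (p/2 * (cmod z)\<^sup>2)) * (\<integral>\<^sup>+ u. (ennreal (fock_wdens 0 p f (z + u)) * indicator (ball z 1) (z + u)) \<partial>lborel)"
      proof (rule nn_integral_cmult)
        have "(\<lambda>w. ennreal (fock_wdens 0 p f w) * indicator (ball z 1) w) \<in> borel_measurable borel"
          by measurable
        then show "(\<lambda>u. ennreal (fock_wdens 0 p f (z + u)) * indicator (ball z 1) (z + u)) \<in> borel_measurable lborel"
          by (rule measurable_compose[rotated]) measurable
      qed
      also have "(\<integral>\<^sup>+ u. (ennreal (fock_wdens 0 p f (z + u)) * indicator (ball z 1) (z + u)) \<partial>lborel) = J"
        unfolding J_def by (rule nn_integral_lborel_translate) measurable
      finally have Ih: "(\<integral>\<^sup>+ u. ennreal (cmod (h u) powr p) * indicator (ball 0 1) u \<partial>lborel) \<le> ennreal (exp (p/2) * exp (p/2 * (cmod z)\<^sup>2) * j)"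
        using j by (simp add: ennreal_mult')
      have hK: "cmod (h u) powr p \<le> K" if "cmod u \<le> 1/2" for u
      proof -
        have "ennreal (cmod (h u) powr p) \<le> ennreal C0 * ennreal (exp (p/2) * exp (p/2 * (cmod z)\<^sup>2) * j)"
          using loc[OF hh that] mult_left_mono[OF Ih, of "ennreal C0"] by (meson order_trans zero_le)
        also have "\<dots> = ennreal K" using C0 j by (simp add: K_def ennreal_mult')
        finally show ?thesis using K by simp
      qed
      define B where "B = K powr (1/p)"
      have B: "0 \<le> B" by (simp add: B_def)
      have hB: "cmod (h u) \<le> B" if "cmod u \<le> 1/2" for u
        using powr_mono2[OF _ _ hK[OF that], of "1/p"] p by (simp add: B_def powr_powr)
      have Bp: "B powr p = K" using p K by (simp add: B_def powr_powr)
      have f0: "f z = h 0" by (simp add: h_def)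
      have f1: "deriv f z = deriv h 0 + cnj z * h 0"
      proof -
        have "(f has_field_derivative deriv f z) (at z)" using f by (simp add: holomorphic_derivI)
        then have "((\<lambda>u. f (z + u)) has_field_derivative deriv f z) (at 0)"
          using DERIV_at_within_shift[of f "deriv f z" z 0 UNIV] by simp
        then have "(h has_field_derivative (deriv f z - cnj z * f z)) (at 0)"
          unfolding h_def by (auto intro!: derivative_eq_intros)
        then have "deriv h 0 = deriv f z - cnj z * f z" by (rule DERIV_imp_deriv)
        then show ?thesis by (simp add: h_def)
      qed
      have dh: "cmod (deriv h 0) \<le> 2 * B"
        using entire_deriv_bound[OF hh, of "1/2" 0 B] hB by simp
      have "cmod ((deriv ^^ i) f z) / (1 + cmod z) ^ i \<le> 2 * B"
      proof (cases "i = 0")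
        case True
        then show ?thesis using hB[of 0] B by (simp add: f0)
      next
        case False
        then have i1: "i = 1" using i by simp
        have "cmod (deriv f z) \<le> cmod (deriv h 0) + cmod z * cmod (h 0)"
          unfolding f1 by (metis norm_triangle_ineq norm_mult complex_mod_cnj)
        also have "\<dots> \<le> 2 * B + cmod z * B"
          using dh hB[of 0] by (intro add_mono mult_left_mono) auto
        also have "\<dots> \<le> 2 * B * (1 + cmod z)"
          using B by (simp add: algebra_simps)
        finally show ?thesis by (simp add: i1 pos_divide_le_eq add_pos_nonneg)
      qed
      then have "(cmod ((deriv ^^ i) f z) / (1 + cmod z) ^ i) powr p \<le> (2 * B) powr p"
        using p by (intro powr_mono2) auto
      also have "\<dots> = 2 powr p * K" using B Bp by (simp add: powr_mult)
      finally have "fock_wdens i p f z \<le> 2 powr p * K * exp (-(p/2) * (cmod z)\<^sup>2)"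
        unfolding fock_wdens_def by (intro mult_right_mono) auto
      also have "\<dots> = C * j" by (simp add: K_def C_def field_simps flip: exp_add)
      finally have "ennreal (fock_wdens i p f z) \<le> ennreal (C * j)" by (rule ennreal_leI)
      then show ?thesis using j C by (simp add: J_def[symmetric] ennreal_mult')
    qed
  qed
  then show ?thesis using C by blast
qed

subsection \<open>Norms and embeddings\<close>

lemma fock_norm_nonneg [simp]: "0 \<le> fock_norm p f"
  by (simp add: fock_norm_def)

lemma fock_norm_powr:
  assumes "0 < p"
  shows "fock_norm p f powr p = p / (2 * pi) * enn2real (fock_integral p f)"
  using assms by (simp add: fock_norm_def powr_powr)

text \<open>Membership matters: \<open>enn2real\<close> would turn an infinite integral into
  0.\<close>

lemma fock_integral_fock_norm:
  assumes "0 < p" "fock_in p f"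
  shows "fock_integral p f = ennreal (2 * pi / p * fock_norm p f powr p)"
proof -
  have "2 * pi / p * fock_norm p f powr p = enn2real (fock_integral p f)"
    unfolding fock_norm_powr[OF assms(1)] using assms(1) by (simp add: field_simps)
  then show ?thesis using assms(2) by (simp add: fock_in_def less_top)
qed

lemma fock_norm_leI:
  assumes p: "0 < p" and K: "0 \<le> K" and le: "fock_integral p f \<le> ennreal K"
  shows "fock_norm p f \<le> (p / (2 * pi) * K) powr (1 / p)"
proof -
  have "enn2real (fock_integral p f) \<le> K"
    using K le by (metis enn2real_ennreal enn2real_mono ennreal_less_top)
  then show ?thesis
    unfolding fock_norm_def using p by (intro powr_mono2 mult_left_mono) auto
qed

text \<open>For exponents below 1 \<open>fock_norm\<close> is not subadditive, so convergence is
  transferred to the integrals, which satisfy a triangle inequality up to the factor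
  \<open>2 powr p\<close>.\<close>

lemma fock_norm_tendsto_zero_iff:
  assumes p: "0 < p" and f: "\<And>n. fock_in p (f n)"
  shows "((\<lambda>n. fock_norm p (f n)) \<longlonglongrightarrow> 0) \<longleftrightarrow> ((\<lambda>n. fock_integral p (f n)) \<longlonglongrightarrow> 0)"
proof
  assume "(\<lambda>n. fock_norm p (f n)) \<longlonglongrightarrow> 0"
  then have "(\<lambda>n. 2 * pi / p * fock_norm p (f n) powr p) \<longlonglongrightarrow> 2 * pi / p * 0 powr p"
    using p by (intro tendsto_intros tendsto_powr') auto
  then have "(\<lambda>n. ennreal (2 * pi / p * fock_norm p (f n) powr p)) \<longlonglongrightarrow> ennreal 0"
    by (intro tendsto_ennrealI) simp
  then show "(\<lambda>n. fock_integral p (f n)) \<longlonglongrightarrow> 0"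
    using fock_integral_fock_norm[OF p f] by simp
next
  assume "(\<lambda>n. fock_integral p (f n)) \<longlonglongrightarrow> 0"
  then have "(\<lambda>n. enn2real (fock_integral p (f n))) \<longlonglongrightarrow> 0"
    using tendsto_enn2real[of "\<lambda>n. fock_integral p (f n)" 0 sequentially] by simp
  then have "(\<lambda>n. (p / (2 * pi) * enn2real (fock_integral p (f n))) powr (1/p)) \<longlonglongrightarrow> (p / (2 * pi) * 0) powr (1/p)"
    using p by (intro tendsto_powr' tendsto_mult_left tendsto_const) auto
  then show "(\<lambda>n. fock_norm p (f n)) \<longlonglongrightarrow> 0" by (simp add: fock_norm_def)
qed

text \<open>The difference is at most twice the larger modulus. This crude bound holds uniformly for
  all exponents \<open>p > 0\<close>.\<close>

lemma powr_diff_le: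
  fixes a b :: complex
  assumes "0 < p"
  shows "cmod (a - b) powr p \<le> 2 powr p * (cmod a powr p + cmod b powr p)"
proof -
  have "cmod (a - b) \<le> 2 * max (cmod a) (cmod b)"
    using norm_triangle_ineq4[of a b] by linarith
  then have "cmod (a - b) powr p \<le> (2 * max (cmod a) (cmod b)) powr p"
    using assms by (intro powr_mono2) auto
  also have "\<dots> = 2 powr p * max (cmod a) (cmod b) powr p"
    by (simp add: powr_mult)
  also have "\<dots> \<le> 2 powr p * (cmod a powr p + cmod b powr p)"
    by (intro mult_left_mono) (auto simp: max_def)
  finally show ?thesis .
qed

lemma fock_integral_diff_le:
  assumes p: "0 < p" and f: "f holomorphic_on UNIV" and g: "g holomorphic_on UNIV"
  shows "fock_integral p (\<lambda>z. f z - g z) \<le> ennreal (2 powr p) * (fock_integral p f + fock_integral p g)"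
proof -
  note [measurable] = fock_wdens_measurable[OF f] fock_wdens_measurable[OF g]
  have "fock_integral p (\<lambda>z. f z - g z) \<le>
     (\<integral>\<^sup>+ z. ennreal (2 powr p) * (ennreal (fock_wdens 0 p f z) + ennreal (fock_wdens 0 p g z)) \<partial>lborel)"
    unfolding fock_integral_eq
  proof (rule nn_integral_mono)
    fix z
    have "fock_wdens 0 p (\<lambda>z. f z - g z) z \<le> 2 powr p * (cmod (f z) powr p + cmod (g z) powr p) * exp (-(p/2) * (cmod z)\<^sup>2)"
      unfolding fock_wdens_def using powr_diff_le[OF p, of "f z" "g z"] by (simp add: mult_right_mono)
    also have "\<dots> = 2 powr p * (fock_wdens 0 p f z + fock_wdens 0 p g z)"
      by (simp add: fock_wdens_def algebra_simps)
    finally show "ennreal (fock_wdens 0 p (\<lambda>z. f z - g z) z) \<le> ennreal (2 powr p) * (ennreal (fock_wdens 0 p f z) + ennreal (fock_wdens 0 p g z))"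
      by (simp flip: ennreal_mult' ennreal_plus add: ennreal_leI)
  qed
  also have "\<dots> = ennreal (2 powr p) * (fock_integral p f + fock_integral p g)"
    by (simp add: fock_integral_eq nn_integral_cmult nn_integral_add)
  finally show ?thesis .
qed

lemma fock_in_diff:
  assumes p: "0 < p" and f: "fock_in p f" and g: "fock_in p g"
  shows "fock_in p (\<lambda>z. f z - g z)"
proof -
  have "fock_integral p (\<lambda>z. f z - g z) \<le> ennreal (2 powr p) * (fock_integral p f + fock_integral p g)"
    using assms by (intro fock_integral_diff_le) (auto simp: fock_in_def)
  also have "\<dots> < \<infinity>" using f g by (auto simp: fock_in_def ennreal_mult_less_top)
  finally show ?thesis using f g by (auto simp: fock_in_def intro!: holomorphic_intros)
qed

lemma fock_wdens_le_fock_integral: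
  assumes p: "0 < p"
  shows "\<exists>C>0. \<forall>f z i. f holomorphic_on UNIV \<longrightarrow> i \<le> 1 \<longrightarrow>
     ennreal (fock_wdens i p f z) \<le> ennreal C * fock_integral p f"
proof -
  obtain C where C: "0 < C" and loc: "\<And>f z i. f holomorphic_on UNIV \<Longrightarrow> i \<le> 1 \<Longrightarrow> ennreal (fock_wdens i p f z) \<le>
       ennreal C * (\<integral>\<^sup>+ w. ennreal (fock_wdens 0 p f w) * indicator (ball z 1) w \<partial>lborel)"
    using fock_wdens_le_nn_integral_ball[OF p] by metis
  have "ennreal C * (\<integral>\<^sup>+ w. ennreal (fock_wdens 0 p f w) * indicator (ball z 1) w \<partial>lborel) \<le> ennreal C * fock_integral p f" for f z
    unfolding fock_integral_eq by (intro mult_left_mono nn_integral_mono) (auto simp: indicator_def)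
  then show ?thesis using C loc by (meson order_trans)
qed

text \<open>The local estimate is enlarged to the whole plane and p-th roots are taken. This
  continuity of point evaluations of \<open>f\<close> and of its derivative is what turns norm
  information into pointwise information, both for symbols and for limits.\<close>

lemma fock_pointwise:
  assumes p: "0 < p"
  shows "\<exists>C>0. \<forall>f z i. fock_in p f \<longrightarrow> i \<le> 1 \<longrightarrow>
     cmod ((deriv ^^ i) f z) \<le> C * (1 + cmod z) ^ i * exp ((cmod z)\<^sup>2 / 2) * fock_norm p f"
proof -
  obtain C where C: "0 < C" and le: "\<And>f z i. f holomorphic_on UNIV \<Longrightarrow> i \<le> 1 \<Longrightarrow> ennreal (fock_wdens i p f z) \<le>
       ennreal C * fock_integral p f"
    using fock_wdens_le_fock_integral[OF p] by metis
  define K where "K = (C * (2 * pi / p)) powr (1/p)"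
  have K: "0 < K" using C p by (simp add: K_def)
  have "cmod ((deriv ^^ i) f z) \<le> K * (1 + cmod z) ^ i * exp ((cmod z)\<^sup>2 / 2) * fock_norm p f"
    if f: "fock_in p f" and i: "i \<le> 1" for f z i
  proof -
    define X where "X = cmod ((deriv ^^ i) f z) / (1 + cmod z) ^ i"
    have X: "0 \<le> X" by (simp add: X_def)
    have "ennreal (fock_wdens i p f z) \<le> ennreal (C * (2 * pi / p * fock_norm p f powr p))"
    proof -
      have "ennreal (fock_wdens i p f z) \<le> ennreal C * ennreal (2 * pi / p * fock_norm p f powr p)"
        using le[of f i z] f i fock_integral_fock_norm[OF p f] by (auto simp: fock_in_def)
      then show ?thesis using C by (subst ennreal_mult') auto
    qed
    then have "X powr p * exp (-(p/2) * (cmod z)\<^sup>2) \<le> C * (2 * pi / p * fock_norm p f powr p)"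
      using C p by (simp add: fock_wdens_def X_def)
    then have "(X powr p * exp (-(p/2) * (cmod z)\<^sup>2)) powr (1/p) \<le> (C * (2 * pi / p * fock_norm p f powr p)) powr (1/p)"
      using p by (intro powr_mono2) auto
    moreover have "(X powr p * exp (-(p/2) * (cmod z)\<^sup>2)) powr (1/p) = X * exp (- ((cmod z)\<^sup>2 / 2))"
      using p X by (simp add: powr_mult powr_powr exp_powr_real)
    moreover have "(C * (2 * pi / p * fock_norm p f powr p)) powr (1/p) = K * fock_norm p f"
    proof -
      have "(C * (2 * pi / p * fock_norm p f powr p)) powr (1/p) = (C * (2 * pi / p)) powr (1/p) * (fock_norm p f powr p) powr (1/p)"
        by (subst powr_mult[symmetric]) (auto simp: mult_ac)
      then show ?thesis using p by (simp add: powr_powr K_def)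
    qed
    ultimately have "X * exp (- ((cmod z)\<^sup>2 / 2)) \<le> K * fock_norm p f" by simp
    then have "X \<le> K * fock_norm p f * exp ((cmod z)\<^sup>2 / 2)"
      by (simp add: exp_minus field_simps)
    then show ?thesis
      unfolding X_def by (subst (asm) pos_divide_le_eq) (auto simp: mult_ac add_pos_nonneg)
  qed
  then show ?thesis using K by blast
qed

text \<open>The q-density is the p-density times the power \<open>q - p\<close> of the weighted
  modulus, and the latter is bounded by a multiple of the norm.\<close>

lemma fock_embedding:
  assumes p: "0 < p" and pq: "p \<le> q"
  shows "\<exists>C\<ge>0. \<forall>f. fock_in p f \<longrightarrow> fock_in q f \<and> fock_integral q f \<le> ennreal (C * fock_norm p f powr q)"
proof -
  obtain K where K: "0 < K" and le: "\<And>f z i. fock_in p f \<Longrightarrow> i \<le> 1 \<Longrightarrow>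
     cmod ((deriv ^^ i) f z) \<le> K * (1 + cmod z) ^ i * exp ((cmod z)\<^sup>2 / 2) * fock_norm p f"
    using fock_pointwise[OF p] by metis
  show ?thesis
  proof (cases "p = q")
    case True
    then show ?thesis
      using p fock_integral_fock_norm[OF p] by (intro exI[of _ "2 * pi / p"]) auto
  next
    case False
    then have q: "0 < q - p" using pq by simp
    define C where "C = K powr (q - p) * (2 * pi / p)"
    have "fock_integral q f \<le> ennreal (C * fock_norm p f powr q)" if f: "fock_in p f" for f
    proof -
      note [measurable] = fock_wdens_measurable[of f]
      have fh: "f holomorphic_on UNIV" using f by (simp add: fock_in_def)
      define N where "N = fock_norm p f"
      have N: "0 \<le> N" by (simp add: N_def)
      have "fock_integral q f \<le> (\<integral>\<^sup>+ z. ennreal ((K * N) powr (q - p)) * ennreal (fock_wdens 0 p f z) \<partial>lborel)"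
        unfolding fock_integral_eq
      proof (rule nn_integral_mono)
        fix z
        have "cmod (f z) * exp (- ((cmod z)\<^sup>2 / 2)) \<le> K * N"
          using le[OF f, of 0 z] by (simp add: N_def exp_minus field_simps)
        then have "(cmod (f z) * exp (- ((cmod z)\<^sup>2 / 2))) powr (q - p) \<le> (K * N) powr (q - p)"
          using q by (intro powr_mono2) auto
        then have "(cmod (f z) * exp (- ((cmod z)\<^sup>2 / 2))) powr (q - p) * fock_wdens 0 p f z \<le> (K * N) powr (q - p) * fock_wdens 0 p f z"
          by (intro mult_right_mono) auto
        moreover have "(cmod (f z) * exp (- ((cmod z)\<^sup>2 / 2))) powr (q - p) * fock_wdens 0 p f z = fock_wdens 0 q f z"
        proof -
          have e: "fock_wdens 0 s f z = (cmod (f z) * exp (- ((cmod z)\<^sup>2 / 2))) powr s" for s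
            by (simp add: fock_wdens_def powr_mult exp_powr_real mult.commute)
          show ?thesis unfolding e by (simp flip: powr_add)
        qed
        ultimately show "ennreal (fock_wdens 0 q f z) \<le> ennreal ((K * N) powr (q - p)) * ennreal (fock_wdens 0 p f z)"
          by (simp flip: ennreal_mult' add: ennreal_leI)
      qed
      also have "\<dots> = ennreal ((K * N) powr (q - p)) * fock_integral p f"
        unfolding fock_integral_eq by (rule nn_integral_cmult) (simp add: fock_wdens_measurable[OF fh])
      also have "\<dots> = ennreal (C * N powr q)"
        unfolding fock_integral_fock_norm[OF p f] N_def[symmetric] using K N p
        by (simp add: C_def powr_mult powr_diff flip: ennreal_mult')
      finally show ?thesis by (simp add: N_def)
    qed
    moreover have "0 \<le> C" using K p by (simp add: C_def)
    moreover have "fock_in q f" if f: "fock_in p f" for f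
    proof -
      have "fock_integral q f < \<infinity>"
        using le_less_trans[OF calculation(1)[OF f] ennreal_less_top] by simp
      then show ?thesis using f by (simp add: fock_in_def)
    qed
    ultimately show ?thesis by blast
  qed
qed

section \<open>Affine substitutions and Gaussian integrals\<close>

text \<open>In place of a change of variables, the density at \<open>a * z + b\<close> is dominated
  by an integral over the unit ball around that point and the integrals are exchanged. For fixed
  \<open>w\<close>, the \<open>z\<close> whose image lies within 1 of \<open>w\<close> form a disc
  of radius \<open>1 / cmod a\<close>. The local estimate simultaneously reduces
  \<open>i = 1\<close> to order 0.\<close>

lemma fock_wdens_affine_le:
  assumes q: "0 < q" and a: "a \<noteq> 0"
  shows "\<exists>C>0. \<forall>f i. f holomorphic_on UNIV \<longrightarrow> i \<le> 1 \<longrightarrow>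
     (\<integral>\<^sup>+ z. ennreal (fock_wdens i q f (a * z + b)) \<partial>lborel) \<le> ennreal C * fock_integral q f"
proof -
  obtain C where C: "0 < C" and loc: "\<And>f z i. f holomorphic_on UNIV \<Longrightarrow> i \<le> 1 \<Longrightarrow> ennreal (fock_wdens i q f z) \<le>
       ennreal C * (\<integral>\<^sup>+ w. ennreal (fock_wdens 0 q f w) * indicator (ball z 1) w \<partial>lborel)"
    using fock_wdens_le_nn_integral_ball[OF q] by metis
  define K where "K = C * (pi * (1 / cmod a)\<^sup>2)"
  have K: "0 < K" using C a by (simp add: K_def)
  have "(\<integral>\<^sup>+ z. ennreal (fock_wdens i q f (a * z + b)) \<partial>lborel) \<le> ennreal K * fock_integral q f"
    if f: "f holomorphic_on UNIV" and i: "i \<le> 1" for f i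
  proof -
    note [measurable] = fock_wdens_measurable[OF f]
    have ind: "indicator (ball (a * z + b) 1) w = (indicator (ball ((w - b) / a) (1 / cmod a)) z :: ennreal)" for z w
    proof -
      have "cmod ((w - b) / a - z) * cmod a = cmod (a * z + b - w)"
      proof -
        have "((w - b) / a - z) * a = w - (a * z + b)" using a by (simp add: field_simps)
        then show ?thesis unfolding norm_mult[symmetric] by (simp add: norm_minus_commute)
      qed
      then have "dist ((w - b) / a) z < 1 / cmod a \<longleftrightarrow> dist (a * z + b) w < 1"
        using a by (simp add: dist_norm field_simps)
      then show ?thesis by (simp add: indicator_def)
    qed
    have "(\<integral>\<^sup>+ z. ennreal (fock_wdens i q f (a * z + b)) \<partial>lborel)
       \<le> (\<integral>\<^sup>+ z. ennreal C * (\<integral>\<^sup>+ w. ennreal (fock_wdens 0 q f w) * indicator {x. dist (a * z + b) x < 1} w \<partial>lborel) \<partial>lborel)"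
      using loc[OF f i] by (intro nn_integral_mono) (simp add: ball_def)
    also have "\<dots> = ennreal C * (\<integral>\<^sup>+ z. (\<integral>\<^sup>+ w. ennreal (fock_wdens 0 q f w) * indicator {x. dist (a * z + b) x < 1} w \<partial>lborel) \<partial>lborel)"
      by (rule nn_integral_cmult) measurable
    also have "(\<integral>\<^sup>+ z. (\<integral>\<^sup>+ w. ennreal (fock_wdens 0 q f w) * indicator {x. dist (a * z + b) x < 1} w \<partial>lborel) \<partial>lborel)
       = (\<integral>\<^sup>+ w. (\<integral>\<^sup>+ z. ennreal (fock_wdens 0 q f w) * indicator {x. dist (a * z + b) x < 1} w \<partial>lborel) \<partial>lborel)"
      by (rule lborel_pair.Fubini') measurable
    also have "\<dots> = (\<integral>\<^sup>+ w. ennreal (fock_wdens 0 q f w) * ennreal (pi * (1 / cmod a)\<^sup>2) \<partial>lborel)"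
    proof (rule nn_integral_cong)
      fix w
      have "(\<integral>\<^sup>+ z. ennreal (fock_wdens 0 q f w) * indicator {x. dist (a * z + b) x < 1} w \<partial>lborel)
         = (\<integral>\<^sup>+ z. ennreal (fock_wdens 0 q f w) * indicator (ball ((w - b) / a) (1 / cmod a)) z \<partial>lborel)"
        using ind by (simp add: ball_def)
      also have "\<dots> = ennreal (fock_wdens 0 q f w) * ennreal (pi * (1 / cmod a)\<^sup>2)"
        by (simp add: nn_integral_cmult_indicator emeasure_ball_complex)
      finally show "(\<integral>\<^sup>+ z. ennreal (fock_wdens 0 q f w) * indicator {x. dist (a * z + b) x < 1} w \<partial>lborel)
         = ennreal (fock_wdens 0 q f w) * ennreal (pi * (1 / cmod a)\<^sup>2)" .
    qed
    also have "\<dots> = fock_integral q f * ennreal (pi * (1 / cmod a)\<^sup>2)"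
      unfolding fock_integral_eq by (rule nn_integral_multc) measurable
    finally show ?thesis using C by (simp add: K_def ennreal_mult' mult_ac)
  qed
  then show ?thesis using K by blast
qed

text \<open>With \<open>k\<close> the integer part of the modulus, each point lies in the ball of
  radius \<open>k + 1\<close> and the integrand is at most its value at radius \<open>k\<close>.
  Ball areas grow quadratically, so the resulting series converges.\<close>

lemma nn_integral_gaussian_finite:
  assumes c: "0 < c"
  shows "(\<integral>\<^sup>+ u. ennreal (exp (- c * (cmod u)\<^sup>2)) \<partial>lborel) < \<infinity>"
proof -
  define F where "F = (\<lambda>k::nat. pi * (real k + 1)\<^sup>2 * exp (- c * (real k)\<^sup>2))"
  have Fs: "summable F"
  proof (rule summable_comparison_test_ev)
    have "eventually (\<lambda>k::nat. pi * (real k + 1)\<^sup>2 * exp (- c * (real k)\<^sup>2) \<le> 1 / (real k)\<^sup>2) sequentially"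
      using c by real_asymp
    then show "eventually (\<lambda>k. norm (F k) \<le> 1 / (real k)\<^sup>2) sequentially"
      by (simp add: F_def)
    show "summable (\<lambda>k. 1 / (real k)\<^sup>2)"
      using inverse_power_summable[of 2, where 'a = real] by (simp add: field_simps)
  qed
  have term_le: "G k \<le> suminf G" for G :: "nat \<Rightarrow> ennreal" and k
    using sum_le_suminf[of G "{k}"] by (simp add: summableI)
  have "(\<integral>\<^sup>+ u. ennreal (exp (- c * (cmod u)\<^sup>2)) \<partial>lborel)
     \<le> (\<integral>\<^sup>+ u. (\<Sum>k. ennreal (exp (- c * (real k)\<^sup>2)) * indicator (ball (0::complex) (real k + 1)) u) \<partial>lborel)"
  proof (rule nn_integral_mono)
    fix u :: complex
    define k where "k = nat \<lfloor>cmod u\<rfloor>"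
    have "real k = of_int \<lfloor>cmod u\<rfloor>" unfolding k_def by simp
    then have k: "real k \<le> cmod u" "cmod u < real k + 1" by linarith+
    have "(real k)\<^sup>2 \<le> (cmod u)\<^sup>2" using k by (intro power_mono) auto
    then have "ennreal (exp (- c * (cmod u)\<^sup>2)) \<le> ennreal (exp (- c * (real k)\<^sup>2)) * indicator (ball (0::complex) (real k + 1)) u"
      using k c by (auto intro!: ennreal_leI)
    also have "\<dots> \<le> (\<Sum>k. ennreal (exp (- c * (real k)\<^sup>2)) * indicator (ball (0::complex) (real k + 1)) u)"
      by (rule term_le)
    finally show "ennreal (exp (- c * (cmod u)\<^sup>2)) \<le> (\<Sum>k. ennreal (exp (- c * (real k)\<^sup>2)) * indicator (ball (0::complex) (real k + 1)) u)" .
  qed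
  also have "\<dots> = (\<Sum>k. \<integral>\<^sup>+ u. ennreal (exp (- c * (real k)\<^sup>2)) * indicator (ball (0::complex) (real k + 1)) u \<partial>lborel)"
    by (rule nn_integral_suminf) measurable
  also have "\<dots> = (\<Sum>k. ennreal (F k))"
  proof (rule suminf_cong)
    fix k
    have "(\<integral>\<^sup>+ u. ennreal (exp (- c * (real k)\<^sup>2)) * indicator (ball (0::complex) (real k + 1)) u \<partial>lborel)
       = ennreal (exp (- c * (real k)\<^sup>2)) * ennreal (pi * (real k + 1)\<^sup>2)"
      by (subst nn_integral_cmult_indicator) (auto simp: emeasure_ball_complex)
    also have "\<dots> = ennreal (F k)" by (simp add: F_def mult.commute flip: ennreal_mult')
    finally show "(\<integral>\<^sup>+ u. ennreal (exp (- c * (real k)\<^sup>2)) * indicator (ball (0::complex) (real k + 1)) u \<partial>lborel) = ennreal (F k)" .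
  qed
  also have "\<dots> = ennreal (suminf F)"
    by (rule suminf_ennreal2[OF _ Fs]) (simp add: F_def)
  also have "\<dots> < \<infinity>" by simp
  finally show ?thesis .
qed

subsection \<open>Control of a function by its derivative\<close>

text \<open>On the ray from 0 to \<open>z\<close> the speed of \<open>F\<close> is compared with the
  derivative of an explicit real function \<open>\<phi>\<close>. Discarding a nonpositive multiple
  of \<open>t * (1 - t)\<close> from the exponent leaves one whose derivative in \<open>t\<close> is
  \<open>t\<close> times half the square of \<open>r\<close>, so the part with the factor
  \<open>t * r\<close> integrates exactly. The constant 7 is 4 plus the bound 3 for
  \<open>exp 1\<close>.\<close>

lemma entire_ray_bound:
  assumes F: "F holomorphic_on UNIV" and F0: "F 0 = 0" and S: "0 \<le> S"
    and bound: "\<And>t. 0 \<le> t \<Longrightarrow> t \<le> 1 \<Longrightarrow> cmod (deriv F (t *\<^sub>R z)) \<le>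
       S * (1 + t * cmod z) * exp (t\<^sup>2 * (cmod z)\<^sup>2 / 2 + (1 - t)\<^sup>2 * (cmod z)\<^sup>2 / 4)"
  shows "cmod (F z) \<le> 7 * S * exp ((cmod z)\<^sup>2 / 2)"
proof -
  define r where "r = cmod z"
  have r: "0 \<le> r" by (simp add: r_def)
  define f where "f = (\<lambda>t::real. F (t *\<^sub>R z))"
  \<comment> \<open>The first exponential is a primitive of the part with factor
    \<open>t * r\<close>. The second pays for the summand 1 in \<open>1 + t * r\<close>, by
    \<open>X2\<close> below.\<close>
  define \<phi> where "\<phi> = (\<lambda>t. S * exp (r\<^sup>2/2) * (4 * exp (-(r\<^sup>2 - t\<^sup>2 * r\<^sup>2)/4) - exp (1 - t * r)))"
  define \<phi>' where "\<phi>' = (\<lambda>t. S * exp (r\<^sup>2/2) * (2 * t * r\<^sup>2 * exp (-(r\<^sup>2 - t\<^sup>2 * r\<^sup>2)/4) + r * exp (1 - t * r)))"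
  have df: "(f has_vector_derivative (z * deriv F (t *\<^sub>R z))) (at t)" for t
  proof -
    have "((\<lambda>t. t *\<^sub>R z) has_vector_derivative z) (at t)"
      by (auto intro!: derivative_eq_intros)
    moreover have "(F has_field_derivative deriv F (t *\<^sub>R z)) (at (t *\<^sub>R z))"
      using F by (simp add: holomorphic_derivI)
    ultimately have "((F \<circ> (\<lambda>t. t *\<^sub>R z)) has_vector_derivative (z * deriv F (t *\<^sub>R z))) (at t)"
      by (rule field_vector_diff_chain_at)
    then show ?thesis by (simp add: f_def o_def)
  qed
  have dphi: "(\<phi> has_vector_derivative \<phi>' t) (at t)" for t
    unfolding \<phi>_def \<phi>'_def has_real_derivative_iff_has_vector_derivative[symmetric]
    by (auto intro!: derivative_eq_intros simp: field_simps)
  have "cmod (f 1 - f 0) \<le> \<phi> 1 - \<phi> 0"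
  proof (rule differentiable_bound_general)
    show "continuous_on {0..1} f"
      using df by (meson continuous_at_imp_continuous_on has_vector_derivative_continuous)
    show "continuous_on {0..1} \<phi>"
      using dphi by (meson continuous_at_imp_continuous_on has_vector_derivative_continuous)
    fix t :: real assume t: "0 < t" "t < 1"
    define X where "X = exp (-(r\<^sup>2 - t\<^sup>2 * r\<^sup>2)/4)"
    have "t\<^sup>2 * r\<^sup>2 \<le> 1 * r\<^sup>2" using t by (intro mult_right_mono power_le_one) auto
    then have X: "X \<le> 1" "0 < X" by (auto simp: X_def)
    \<comment> \<open>For \<open>t * r \<ge> 1\<close> the first summand suffices. Otherwise the
      exponential exceeds 1, which bounds \<open>X\<close>.\<close>
    have X2: "X \<le> t * r * X + exp (1 - t * r)"
    proof (cases "t * r \<ge> 1")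
      case True
      then have "1 * X \<le> t * r * X" using X by (intro mult_right_mono) auto
      then show ?thesis by (simp add: add_increasing2)
    next
      case False
      then have "1 \<le> exp (1 - t * r)" by simp
      then show ?thesis using X t r by (smt (verit) mult_nonneg_nonneg)
    qed
    have "t\<^sup>2 * r\<^sup>2 / 2 + (1 - t)\<^sup>2 * r\<^sup>2 / 4 = r\<^sup>2/2 + -(r\<^sup>2 - t\<^sup>2 * r\<^sup>2)/4 - t * (1 - t) * r\<^sup>2 / 2"
      by (simp add: power2_eq_square field_simps)
    also have "\<dots> \<le> r\<^sup>2/2 + -(r\<^sup>2 - t\<^sup>2 * r\<^sup>2)/4"
    proof -
      have "0 \<le> t * (1 - t) * r\<^sup>2 / 2" using t by simp
      then show ?thesis by argo
    qed
    finally have "exp (t\<^sup>2 * r\<^sup>2 / 2 + (1 - t)\<^sup>2 * r\<^sup>2 / 4) \<le> exp (r\<^sup>2/2) * X"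
      unfolding X_def by (simp flip: exp_add)
    then have "S * (1 + t * r) * exp (t\<^sup>2 * r\<^sup>2 / 2 + (1 - t)\<^sup>2 * r\<^sup>2 / 4) \<le> S * (1 + t * r) * (exp (r\<^sup>2/2) * X)"
      using S t r by (intro mult_left_mono) auto
    then have "cmod (deriv F (t *\<^sub>R z)) \<le> S * (1 + t * r) * (exp (r\<^sup>2/2) * X)"
      using bound[of t] t by (simp add: r_def)
    also have "\<dots> = S * exp (r\<^sup>2/2) * (X + t * r * X)" by (simp add: algebra_simps)
    also have "\<dots> \<le> S * exp (r\<^sup>2/2) * (2 * t * r * X + exp (1 - t * r))"
      using S X2 by (intro mult_left_mono) (auto simp: mult_ac)
    finally have "r * cmod (deriv F (t *\<^sub>R z)) \<le> r * (S * exp (r\<^sup>2/2) * (2 * t * r * X + exp (1 - t * r)))"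
      using r by (intro mult_left_mono)
    also have "\<dots> = \<phi>' t"
      unfolding \<phi>'_def X_def[symmetric] by (simp add: algebra_simps power2_eq_square)
    finally show "cmod (z * deriv F (t *\<^sub>R z)) \<le> \<phi>' t"
      by (simp add: norm_mult r_def[symmetric])
  qed (use df dphi in auto)
  also have "\<phi> 1 - \<phi> 0 = S * exp (r\<^sup>2/2) * (4 - exp (1 - r) - 4 * exp (-(r\<^sup>2/4)) + exp 1)"
    by (simp add: \<phi>_def algebra_simps)
  also have "\<dots> \<le> S * exp (r\<^sup>2/2) * 7"
  proof -
    have "4 - exp (1 - r) - 4 * exp (-(r\<^sup>2/4)) + exp 1 \<le> 7"
      using exp_le exp_gt_zero[of "1 - r"] exp_gt_zero[of "-(r\<^sup>2/4)"] by linarith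
    then show ?thesis using S by (intro mult_left_mono) auto
  qed
  finally show ?thesis by (simp add: f_def F0 r_def mult_ac)
qed

lemma power2_dist_le: "(cmod (z - w))\<^sup>2 \<le> 2 * (cmod (z - x))\<^sup>2 + 2 * (cmod (x - w))\<^sup>2"
proof -
  have "(cmod (z - w))\<^sup>2 \<le> (cmod (z - x) + cmod (x - w))\<^sup>2"
    using norm_triangle_ineq[of "z - x" "x - w"] by (intro power_mono) auto
  also have "\<dots> \<le> 2 * (cmod (z - x))\<^sup>2 + 2 * (cmod (x - w))\<^sup>2"
    using sum_squares_bound[of "cmod (z - x)" "cmod (x - w)"] by (simp add: power2_sum)
  finally show ?thesis .
qed

text \<open>The local estimate of order 0 is applied to \<open>deriv F\<close>. On a unit ball the
  factor \<open>1 + cmod w\<close> is at most twice its value at the centre, so the weight can be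
  divided out again.\<close>

lemma fock_wdens_1_le_nn_integral_ball:
  assumes q: "0 < q"
  shows "\<exists>C>0. \<forall>F z. F holomorphic_on UNIV \<longrightarrow>
     ennreal (fock_wdens 1 q F z) \<le>
       ennreal C * (\<integral>\<^sup>+ w. ennreal (fock_wdens 1 q F w) * indicator (ball z 1) w \<partial>lborel)"
proof -
  obtain C where C: "0 < C" and loc: "\<And>f z i. f holomorphic_on UNIV \<Longrightarrow> i \<le> 1 \<Longrightarrow> ennreal (fock_wdens i q f z) \<le>
       ennreal C * (\<integral>\<^sup>+ w. ennreal (fock_wdens 0 q f w) * indicator (ball z 1) w \<partial>lborel)"
    using fock_wdens_le_nn_integral_ball[OF q] by metis
  have "ennreal (fock_wdens 1 q F z) \<le>
       ennreal (C * 2 powr q) * (\<integral>\<^sup>+ w. ennreal (fock_wdens 1 q F w) * indicator (ball z 1) w \<partial>lborel)"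
    if F: "F holomorphic_on UNIV" for F z
  proof -
    note [measurable] = fock_wdens_measurable[OF F]
    have dF: "deriv F holomorphic_on UNIV" using F by (simp add: holomorphic_deriv)
    have rel: "fock_wdens 0 q (deriv F) w = (1 + cmod w) powr q * fock_wdens 1 q F w" for w
    proof -
      have "cmod (deriv F w) powr q = ((1 + cmod w) * (cmod (deriv F w) / (1 + cmod w))) powr q"
        by (simp add: add_nonneg_eq_0_iff)
      also have "\<dots> = (1 + cmod w) powr q * (cmod (deriv F w) / (1 + cmod w)) powr q"
        by (rule powr_mult)
      finally show ?thesis by (simp add: fock_wdens_def)
    qed
    have "ennreal ((1 + cmod z) powr q) * ennreal (fock_wdens 1 q F z) = ennreal (fock_wdens 0 q (deriv F) z)"
      by (simp add: rel ennreal_mult')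
    also have "\<dots> \<le> ennreal C * (\<integral>\<^sup>+ w. ennreal (fock_wdens 0 q (deriv F) w) * indicator (ball z 1) w \<partial>lborel)"
      by (rule loc[OF dF]) simp
    also have "\<dots> \<le> ennreal C * (\<integral>\<^sup>+ w. ennreal (2 powr q * (1 + cmod z) powr q) * (ennreal (fock_wdens 1 q F w) * indicator (ball z 1) w) \<partial>lborel)"
    proof (intro mult_left_mono nn_integral_mono)
      fix w
      have "fock_wdens 0 q (deriv F) w \<le> 2 powr q * (1 + cmod z) powr q * fock_wdens 1 q F w" if "dist z w < 1"
      proof -
        have "1 + cmod w \<le> 2 * (1 + cmod z)"
          using that norm_triangle_sub[of w z] norm_ge_zero[of z] unfolding dist_norm norm_minus_commute[of z w] by argo
        then have "(1 + cmod w) powr q \<le> (2 * (1 + cmod z)) powr q" using q by (intro powr_mono2) auto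
        then show ?thesis unfolding rel powr_mult by (intro mult_right_mono) auto
      qed
      then show "ennreal (fock_wdens 0 q (deriv F) w) * indicator (ball z 1) w \<le> ennreal (2 powr q * (1 + cmod z) powr q) * (ennreal (fock_wdens 1 q F w) * indicator (ball z 1) w)"
        by (auto simp: indicator_def ennreal_mult'[symmetric] intro!: ennreal_leI)
    qed auto
    also have "\<dots> = ennreal C * (ennreal (2 powr q * (1 + cmod z) powr q) * (\<integral>\<^sup>+ w. ennreal (fock_wdens 1 q F w) * indicator (ball z 1) w \<partial>lborel))"
      by (subst nn_integral_cmult) auto
    also have "\<dots> = ennreal ((1 + cmod z) powr q) * (ennreal (C * 2 powr q) * (\<integral>\<^sup>+ w. ennreal (fock_wdens 1 q F w) * indicator (ball z 1) w \<partial>lborel))"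
      using C by (simp add: ennreal_mult' mult_ac)
    finally show ?thesis
      by (subst (asm) ennreal_mult_le_mult_iff) (auto simp: add_nonneg_eq_0_iff)
  qed
  then show ?thesis using C by (intro exI[of _ "C * 2 powr q"]) auto
qed

text \<open>The convolution \<open>K\<close> of the derivative density with a Gaussian bounds the
  derivative along the whole segment from 0 to \<open>z\<close>, which is the input of
  \<open>entire_ray_bound\<close>. Fubini and translation invariance then give the integral of
  \<open>K\<close> as \<open>G\<close> times that of the density.\<close>

lemma fock_integral_le_deriv:
  assumes q: "0 < q"
  shows "\<exists>C>0. \<forall>F. F holomorphic_on UNIV \<longrightarrow> F 0 = 0 \<longrightarrow>
     fock_integral q F \<le> ennreal C * (\<integral>\<^sup>+ z. ennreal (fock_wdens 1 q F z) \<partial>lborel)"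
proof -
  obtain C where C: "0 < C" and loc: "\<And>F z. F holomorphic_on UNIV \<Longrightarrow> ennreal (fock_wdens 1 q F z) \<le>
       ennreal C * (\<integral>\<^sup>+ w. ennreal (fock_wdens 1 q F w) * indicator (ball z 1) w \<partial>lborel)"
    using fock_wdens_1_le_nn_integral_ball[OF q] by metis
  define G where "G = enn2real (\<integral>\<^sup>+ u. ennreal (exp (- (q/8) * (cmod u)\<^sup>2)) \<partial>lborel)"
  have G: "(\<integral>\<^sup>+ u. ennreal (exp (- (q/8) * (cmod u)\<^sup>2)) \<partial>lborel) = ennreal G"
    using nn_integral_gaussian_finite[of "q/8"] q unfolding G_def by (simp add: less_top)
  have G0: "0 \<le> G" by (simp add: G_def)
  define L where "L = 7 powr q * (C * exp (q/4))"
  have L: "0 < L" using C by (simp add: L_def)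
  have main: "fock_integral q F \<le> ennreal (L * (G + 1)) * (\<integral>\<^sup>+ z. ennreal (fock_wdens 1 q F z) \<partial>lborel)"
    if F: "F holomorphic_on UNIV" and F0: "F 0 = 0" for F
  proof -
    note [measurable] = fock_wdens_measurable[OF F]
    \<comment> \<open>The distance is written with \<open>- w + z\<close> so that the inner integral
      over \<open>z\<close> is literally a translate by \<open>- w\<close>.\<close>
    define K where "K = (\<lambda>z. \<integral>\<^sup>+ w. ennreal (fock_wdens 1 q F w) * ennreal (exp (- (q/8) * (cmod (- w + z))\<^sup>2)) \<partial>lborel)"
    have pt: "ennreal (fock_wdens 0 q F z) \<le> ennreal L * K z" for z
    proof (cases "K z = \<infinity>")
      case True
      then show ?thesis using L by (simp add: ennreal_mult_top)
    next
      case False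
      then obtain \<kappa> where \<kappa>: "0 \<le> \<kappa>" "K z = ennreal \<kappa>" by (cases "K z") auto
      \<comment> \<open>\<open>S\<close> is a q-th root because densities are q-th powers. It does
        not depend on the point of the segment.\<close>
      define S where "S = (C * exp (q/4) * \<kappa>) powr (1/q)"
      have S: "0 \<le> S" by (simp add: S_def)
      have "cmod (deriv F (t *\<^sub>R z)) \<le>
         S * (1 + t * cmod z) * exp (t\<^sup>2 * (cmod z)\<^sup>2 / 2 + (1 - t)\<^sup>2 * (cmod z)\<^sup>2 / 4)"
        if t: "0 \<le> t" "t \<le> 1" for t
      proof -
        define x where "x = t *\<^sub>R z"
        have xn: "cmod x = t * cmod z" using t by (simp add: x_def)
        have zx: "cmod (z - x) = (1 - t) * cmod z"
        proof -
          have "z - x = (1 - t) *\<^sub>R z" by (simp add: x_def algebra_simps)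
          then show ?thesis using t by simp
        qed
        have "ennreal (exp (- (q/4) * (cmod (z - x))\<^sup>2)) * ennreal (fock_wdens 1 q F x) \<le>
           ennreal (exp (- (q/4) * (cmod (z - x))\<^sup>2)) * (ennreal C * (\<integral>\<^sup>+ w. ennreal (fock_wdens 1 q F w) * indicator (ball x 1) w \<partial>lborel))"
          by (intro mult_left_mono loc[OF F]) auto
        also have "\<dots> = ennreal C * (\<integral>\<^sup>+ w. ennreal (exp (- (q/4) * (cmod (z - x))\<^sup>2)) * (ennreal (fock_wdens 1 q F w) * indicator (ball x 1) w) \<partial>lborel)"
          by (subst nn_integral_cmult) (auto simp: mult_ac)
        also have "\<dots> \<le> ennreal C * (\<integral>\<^sup>+ w. ennreal (exp (q/4)) * (ennreal (fock_wdens 1 q F w) * ennreal (exp (- (q/8) * (cmod (- w + z))\<^sup>2))) \<partial>lborel)"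
        proof (intro mult_left_mono nn_integral_mono)
          fix w
          \<comment> \<open>The rate drops from q/4 to q/8 because the squared distance from
            \<open>z\<close> to \<open>w\<close> is at most twice that to \<open>x\<close> plus 2.
            That summand 2 produces the constant \<open>exp (q/4)\<close>.\<close>
          have "exp (- (q/4) * (cmod (z - x))\<^sup>2) \<le> exp (q/4) * exp (- (q/8) * (cmod (- w + z))\<^sup>2)" if "dist x w < 1"
          proof -
            have "(cmod (x - w))\<^sup>2 \<le> 1" using that by (simp add: dist_norm power_le_one)
            then have "(cmod (- w + z))\<^sup>2 \<le> 2 * (cmod (z - x))\<^sup>2 + 2"
              using power2_dist_le[of z w x] by simp
            then have "q/8 * (cmod (- w + z))\<^sup>2 \<le> q/8 * (2 * (cmod (z - x))\<^sup>2 + 2)"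
              using q by (intro mult_left_mono) auto
            then have "- (q/4) * (cmod (z - x))\<^sup>2 \<le> q/4 + - (q/8) * (cmod (- w + z))\<^sup>2"
              by (simp add: algebra_simps)
            then show ?thesis by (simp flip: exp_add)
          qed
          then have "exp (- (q/4) * (cmod (z - x))\<^sup>2) * fock_wdens 1 q F w \<le> exp (q/4) * exp (- (q/8) * (cmod (- w + z))\<^sup>2) * fock_wdens 1 q F w" if "dist x w < 1"
            using that by (intro mult_right_mono) auto
          then show "ennreal (exp (- (q/4) * (cmod (z - x))\<^sup>2)) * (ennreal (fock_wdens 1 q F w) * indicator (ball x 1) w) \<le>
             ennreal (exp (q/4)) * (ennreal (fock_wdens 1 q F w) * ennreal (exp (- (q/8) * (cmod (- w + z))\<^sup>2)))"
            by (auto simp: indicator_def ennreal_mult'[symmetric] mult_ac intro!: ennreal_leI)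
        qed auto
        also have "\<dots> = ennreal C * (ennreal (exp (q/4)) * K z)"
          unfolding K_def by (subst nn_integral_cmult) auto
        also have "\<dots> = ennreal (C * exp (q/4) * \<kappa>)"
          using \<kappa> C by (simp add: ennreal_mult' mult_ac)
        finally have "exp (- (q/4) * (cmod (z - x))\<^sup>2) * fock_wdens 1 q F x \<le> C * exp (q/4) * \<kappa>"
          using \<kappa> C by (simp flip: ennreal_mult')
        then have "(exp (- (q/4) * (cmod (z - x))\<^sup>2) * fock_wdens 1 q F x) powr (1/q) \<le> S"
          unfolding S_def using q by (intro powr_mono2) auto
        moreover have "(exp (- (q/4) * (cmod (z - x))\<^sup>2) * fock_wdens 1 q F x) powr (1/q)
           = exp (- (cmod (z - x))\<^sup>2 / 4) * (cmod (deriv F x) / (1 + cmod x) * exp (- (cmod x)\<^sup>2 / 2))"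
          using q by (simp add: fock_wdens_def powr_mult powr_powr exp_powr_real)
        ultimately have *: "exp (- (cmod (z - x))\<^sup>2 / 4) * (cmod (deriv F x) / (1 + cmod x) * exp (- (cmod x)\<^sup>2 / 2)) \<le> S"
          by simp
        have "cmod (deriv F x) = (exp (- (cmod (z - x))\<^sup>2 / 4) * (cmod (deriv F x) / (1 + cmod x) * exp (- (cmod x)\<^sup>2 / 2)))
           * ((1 + cmod x) * exp ((cmod x)\<^sup>2 / 2 + (cmod (z - x))\<^sup>2 / 4))"
          unfolding exp_add by (simp add: exp_minus nonzero_divide_eq_eq nonzero_eq_divide_eq add_nonneg_eq_0_iff)
            (simp add: field_simps)
        also have "\<dots> \<le> S * ((1 + cmod x) * exp ((cmod x)\<^sup>2 / 2 + (cmod (z - x))\<^sup>2 / 4))"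
          using * by (intro mult_right_mono) auto
        finally show ?thesis
          unfolding xn zx by (simp add: x_def power_mult_distrib mult_ac)
      qed
      from entire_ray_bound[OF F F0 S this]
      have "cmod (F z) \<le> 7 * S * exp ((cmod z)\<^sup>2 / 2)" .
      then have "cmod (F z) powr q \<le> (7 * S * exp ((cmod z)\<^sup>2 / 2)) powr q"
        using q by (intro powr_mono2) auto
      also have "\<dots> = L * \<kappa> * exp (q / 2 * (cmod z)\<^sup>2)"
        using q C \<kappa> by (simp add: S_def L_def powr_mult powr_powr exp_powr_real mult_ac)
      finally have "fock_wdens 0 q F z \<le> L * \<kappa> * exp (q / 2 * (cmod z)\<^sup>2) * exp (-(q/2) * (cmod z)\<^sup>2)"
        unfolding fock_wdens_def by (auto intro: mult_right_mono)
      also have "\<dots> = L * \<kappa>" by (simp flip: exp_add)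
      finally show ?thesis using \<kappa> L by (simp add: ennreal_leI flip: ennreal_mult')
    qed
    have "fock_integral q F \<le> (\<integral>\<^sup>+ z. ennreal L * K z \<partial>lborel)"
      unfolding fock_integral_eq by (intro nn_integral_mono pt)
    also have "\<dots> = ennreal L * (\<integral>\<^sup>+ z. K z \<partial>lborel)"
      unfolding K_def by (rule nn_integral_cmult) measurable
    also have "(\<integral>\<^sup>+ z. K z \<partial>lborel) = (\<integral>\<^sup>+ w. (\<integral>\<^sup>+ z. ennreal (fock_wdens 1 q F w) * ennreal (exp (- (q/8) * (cmod (- w + z))\<^sup>2)) \<partial>lborel) \<partial>lborel)"
      unfolding K_def by (rule lborel_pair.Fubini') measurable
    also have "\<dots> = (\<integral>\<^sup>+ w. ennreal (fock_wdens 1 q F w) * ennreal G \<partial>lborel)"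
    proof (rule nn_integral_cong)
      fix w
      have "(\<integral>\<^sup>+ z. ennreal (fock_wdens 1 q F w) * ennreal (exp (- (q/8) * (cmod (- w + z))\<^sup>2)) \<partial>lborel)
          = ennreal (fock_wdens 1 q F w) * (\<integral>\<^sup>+ z. ennreal (exp (- (q/8) * (cmod (- w + z))\<^sup>2)) \<partial>lborel)"
        by (rule nn_integral_cmult) measurable
      also have "(\<integral>\<^sup>+ z. ennreal (exp (- (q/8) * (cmod (- w + z))\<^sup>2)) \<partial>lborel) = ennreal G"
        unfolding G[symmetric] by (rule nn_integral_lborel_translate) measurable
      finally show "(\<integral>\<^sup>+ z. ennreal (fock_wdens 1 q F w) * ennreal (exp (- (q/8) * (cmod (- w + z))\<^sup>2)) \<partial>lborel)
          = ennreal (fock_wdens 1 q F w) * ennreal G" .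
    qed
    also have "\<dots> = (\<integral>\<^sup>+ w. ennreal (fock_wdens 1 q F w) \<partial>lborel) * ennreal G"
      by (rule nn_integral_multc) measurable
    also have "ennreal L * ((\<integral>\<^sup>+ w. ennreal (fock_wdens 1 q F w) \<partial>lborel) * ennreal G)
       = ennreal (L * G) * (\<integral>\<^sup>+ w. ennreal (fock_wdens 1 q F w) \<partial>lborel)"
      unfolding ennreal_mult[OF less_imp_le[OF L] G0] by (simp only: mult_ac)
    \<comment> \<open>Passing to \<open>G + 1\<close> makes the constant positive without showing
      that \<open>G\<close> is.\<close>
    also have "\<dots> \<le> ennreal (L * (G + 1)) * (\<integral>\<^sup>+ w. ennreal (fock_wdens 1 q F w) \<partial>lborel)"
      using L by (intro mult_right_mono ennreal_leI) auto
    finally show ?thesis .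
  qed
  have "0 < L * (G + 1)" using L G0 by simp
  then show ?thesis using main by blast
qed

subsection \<open>Affine symbols\<close>

text \<open>Two successive difference quotients at 0 have removable singularities. The second one is
  \<open>\<phi>\<close>, whose value at 0 is the second Taylor coefficient.\<close>

lemma entire_second_order_expansion:
  assumes f: "f holomorphic_on UNIV"
  obtains \<phi> where "\<phi> holomorphic_on UNIV" "\<And>u. f u = f 0 + deriv f 0 * u + u\<^sup>2 * \<phi> u" "deriv (deriv f) 0 = 2 * \<phi> 0"
proof -
  define g where "g = (\<lambda>z. if z = 0 then deriv f 0 else (f z - f 0) / (z - 0))"
  define \<phi> where "\<phi> = (\<lambda>z. if z = 0 then deriv g 0 else (g z - g 0) / (z - 0))"
  have g: "g holomorphic_on UNIV" unfolding g_def by (rule pole_lemma_open[OF f]) simp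
  have \<phi>: "\<phi> holomorphic_on UNIV" unfolding \<phi>_def by (rule pole_lemma_open[OF g]) simp
  have e: "f u = f 0 + deriv f 0 * u + u\<^sup>2 * \<phi> u" for u
    by (auto simp: \<phi>_def g_def power2_eq_square field_simps)
  \<comment> \<open>Naming the two coefficients keeps \<open>f\<close> off the right-hand side of
    \<open>e'\<close>, which is then usable for unfolding.\<close>
  define c0 c1 where "c0 = f 0" and "c1 = deriv f 0"
  have d\<phi>: "(\<phi> has_field_derivative deriv \<phi> u) (at u)" for u
    using \<phi> by (simp add: holomorphic_derivI)
  have dd\<phi>: "(deriv \<phi> has_field_derivative deriv (deriv \<phi>) u) (at u)" for u
    by (rule holomorphic_derivI[OF holomorphic_deriv[OF \<phi> open_UNIV] open_UNIV UNIV_I])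
  have e': "f = (\<lambda>u. c0 + c1 * u + u\<^sup>2 * \<phi> u)"
    unfolding c0_def c1_def by (rule ext, rule e)
  have "(f has_field_derivative (c1 + 2 * u * \<phi> u + u\<^sup>2 * deriv \<phi> u)) (at u)" for u
    unfolding e' by (auto intro!: derivative_eq_intros d\<phi>)
  then have d: "deriv f = (\<lambda>u. c1 + 2 * u * \<phi> u + u\<^sup>2 * deriv \<phi> u)"
    by (intro ext DERIV_imp_deriv)
  have "(deriv f has_field_derivative (2 * \<phi> 0)) (at 0)"
    unfolding d by (auto intro!: derivative_eq_intros d\<phi> dd\<phi>)
  then have "deriv (deriv f) 0 = 2 * \<phi> 0" by (rule DERIV_imp_deriv)
  with \<phi> e show ?thesis by (rule that)
qed

text \<open>On the circle \<open>|u| = r\<close> take \<open>w\<close> with \<open>cnj w\<close> proportional to \<open>r\<^sup>2 / u\<^sup>2\<close>; then \<open>Re (cnj w * f u)\<close> is the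
  real part of a function holomorphic in the disc (\<open>1/u\<close> being replaced by \<open>cnj u / r\<^sup>2\<close>), whose value at \<open>0\<close>
  is the second Taylor coefficient.\<close>
lemma second_deriv_zero_if_exp_growth:
  fixes f m :: "complex \<Rightarrow> complex"
  assumes f: "f holomorphic_on UNIV" and m: "m holomorphic_on UNIV" and m0: "m 0 \<noteq> 0"
    and R: "0 \<le> R" and C: "0 \<le> C"
    and le: "\<And>u. cmod (m u) * exp ((cmod (f u))\<^sup>2 / 2) \<le> C * (1 + (cmod u + R)) * exp ((cmod u + R)\<^sup>2 / 2)"
  shows "deriv (deriv f) 0 = 0"
proof -
  obtain \<phi> where \<phi>: "\<phi> holomorphic_on UNIV" and ex: "\<And>u. f u = f 0 + deriv f 0 * u + u\<^sup>2 * \<phi> u"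
    and dd: "deriv (deriv f) 0 = 2 * \<phi> 0"
    using entire_second_order_expansion[OF f] by blast
  define c where "c = \<phi> 0"
  have "c = 0"
  proof (rule ccontr)
    assume c: "c \<noteq> 0"
    \<comment> \<open>The unimodular factor that rotates \<open>c\<close> onto the positive
      axis.\<close>
    define e where "e = cnj c / cmod c"
    have e1: "cmod e = 1" using c by (simp add: e_def norm_divide)
    have ec: "e * c = cmod c"
      using c by (simp add: e_def complex_norm_square[symmetric] mult.commute power2_eq_square)
    have main: "cmod (m 0) * exp ((cmod c * r\<^sup>2)\<^sup>2 / 2) \<le> C * (1 + (r + R)) * exp ((r + R)\<^sup>2 / 2)" if r: "0 < r" for r :: real
    proof -
      \<comment> \<open>The modulus of the auxiliary \<open>w\<close>. It makes \<open>h 0\<close>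
        equal to the square of \<open>s\<close>, whereas the bound \<open>s * cmod (f u)\<close> on
        the circle costs only half that square after the arithmetic-geometric mean inequality. The
        other half is the gain.\<close>
      define s where "s = cmod c * r\<^sup>2"
      have s: "0 \<le> s" by (simp add: s_def)
      \<comment> \<open>The terms of negative degree in \<open>u\<close> are replaced by their
        conjugates on the circle, which leaves the real part there unchanged and makes
        \<open>h\<close> entire.\<close>
      define h where "h = (\<lambda>u. of_real (s * r\<^sup>2) * (cnj (e * f 0) * u\<^sup>2 / of_real (r^4) + cnj (e * deriv f 0) * u / of_real (r\<^sup>2) + e * \<phi> u))"
      define H where "H = (\<lambda>u. m u * exp (h u))"
      have Hh: "H holomorphic_on UNIV"
        unfolding H_def h_def by (intro holomorphic_intros m \<phi>) (use r in auto)
      \<comment> \<open>The Cauchy inequality of order 0 serves as the maximum principle.\<close>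
      have "cmod ((deriv ^^ 0) H 0) \<le> fact 0 * (C * (1 + (r + R)) * exp ((r + R)\<^sup>2 / 2) * exp (s\<^sup>2 / 2)) / r ^ 0"
      proof (rule entire_Cauchy_inequality[OF Hh r])
        fix u assume "cmod (0 - u) = r"
        then have u: "cmod u = r" by simp
        then have u0: "u \<noteq> 0" using r by auto
        have cu: "cnj u = of_real (r\<^sup>2) / u"
          using u u0 by (simp add: complex_norm_square[symmetric] field_simps flip: u)
        define w where "w = cnj (of_real s * e * of_real (r\<^sup>2) / u\<^sup>2)"
        have wn: "cmod w = s" using u r s e1 by (simp add: w_def norm_mult norm_divide norm_power)
        have "Re (cnj w * f u) = Re (h u)"
        proof -
          have "cnj w * f u = of_real (s * r\<^sup>2) * (e * f 0 / u\<^sup>2 + e * deriv f 0 / u + e * \<phi> u)"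
            using u0 by (subst ex) (simp add: w_def field_simps power2_eq_square)
          moreover have "Re (e * f 0 / u\<^sup>2) = Re (cnj (e * f 0) * u\<^sup>2 / of_real (r^4))"
          proof -
            have "cnj (e * f 0 / u\<^sup>2) = cnj (e * f 0) * u\<^sup>2 / of_real (r^4)"
              using u0 r by (simp add: cu field_simps power2_eq_square power4_eq_xxxx)
            then show ?thesis by (metis complex_cnj(1) cnj.sel(1))
          qed
          moreover have "Re (e * deriv f 0 / u) = Re (cnj (e * deriv f 0) * u / of_real (r\<^sup>2))"
          proof -
            have "cnj (e * deriv f 0 / u) = cnj (e * deriv f 0) * u / of_real (r\<^sup>2)"
              using u0 r by (simp add: cu field_simps)
            then show ?thesis by (metis complex_cnj(1) cnj.sel(1))
          qed
          ultimately show ?thesis by (simp add: h_def)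
        qed
        moreover have "Re (cnj w * f u) \<le> s\<^sup>2 / 2 + (cmod (f u))\<^sup>2 / 2"
        proof -
          have "Re (cnj w * f u) \<le> cmod (cnj w * f u)" by (rule complex_Re_le_cmod)
          also have "\<dots> = s * cmod (f u)" by (simp add: norm_mult wn)
          also have "\<dots> \<le> s\<^sup>2 / 2 + (cmod (f u))\<^sup>2 / 2"
            using sum_squares_bound[of s "cmod (f u)"] by simp
          finally show ?thesis .
        qed
        ultimately have "exp (Re (h u)) \<le> exp (s\<^sup>2 / 2) * exp ((cmod (f u))\<^sup>2 / 2)"
          by (simp flip: exp_add)
        then have "cmod (H u) \<le> cmod (m u) * (exp (s\<^sup>2 / 2) * exp ((cmod (f u))\<^sup>2 / 2))"
          unfolding H_def norm_mult by (intro mult_left_mono) auto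
        also have "\<dots> = cmod (m u) * exp ((cmod (f u))\<^sup>2 / 2) * exp (s\<^sup>2 / 2)" by simp
        also have "\<dots> \<le> C * (1 + (r + R)) * exp ((r + R)\<^sup>2 / 2) * exp (s\<^sup>2 / 2)"
          using le[of u] u by (intro mult_right_mono) auto
        finally show "cmod (H u) \<le> C * (1 + (r + R)) * exp ((r + R)\<^sup>2 / 2) * exp (s\<^sup>2 / 2)" .
      qed
      moreover have "cmod (H 0) = cmod (m 0) * (exp (s\<^sup>2 / 2) * exp (s\<^sup>2 / 2))"
      proof -
        have "h 0 = of_real (s\<^sup>2)"
        proof -
          have "h 0 = of_real (s * r\<^sup>2) * (e * c)" by (simp add: h_def c_def)
          then show ?thesis unfolding ec by (simp add: s_def power2_eq_square mult_ac)
        qed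
        then show ?thesis by (simp add: H_def norm_mult norm_exp_eq_Re flip: exp_add)
      qed
      ultimately have "cmod (m 0) * exp (s\<^sup>2 / 2) * exp (s\<^sup>2 / 2) \<le> C * (1 + (r + R)) * exp ((r + R)\<^sup>2 / 2) * exp (s\<^sup>2 / 2)"
        by simp
      then show ?thesis unfolding s_def by (simp add: mult_le_cancel_right)
    qed
    define k where "k = cmod c"
    have k: "0 < k" using c by (simp add: k_def)
    \<comment> \<open>The negative fourth power of \<open>r\<close> in the exponent outweighs the
      quadratic growth.\<close>
    have "((\<lambda>r. C * (1 + (r + R)) * exp ((r + R)\<^sup>2 / 2 - (k * r\<^sup>2)\<^sup>2 / 2)) \<longlongrightarrow> 0) at_top"
      using k by real_asymp
    moreover have "0 < cmod (m 0)" using m0 by simp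
    ultimately have "eventually (\<lambda>r. C * (1 + (r + R)) * exp ((r + R)\<^sup>2 / 2 - (k * r\<^sup>2)\<^sup>2 / 2) < cmod (m 0)) at_top"
      by (rule order_tendstoD)
    then obtain r where r: "0 < r" "C * (1 + (r + R)) * exp ((r + R)\<^sup>2 / 2 - (k * r\<^sup>2)\<^sup>2 / 2) < cmod (m 0)"
      by (metis (mono_tags, lifting) eventually_at_top_linorder eventually_conj eventually_gt_at_top order_refl)
    from main[OF r(1)] have "cmod (m 0) \<le> C * (1 + (r + R)) * exp ((r + R)\<^sup>2 / 2 - (k * r\<^sup>2)\<^sup>2 / 2)"
      unfolding exp_diff by (simp add: k_def pos_le_divide_eq)
    with r(2) show False by simp
  qed
  then show ?thesis using dd by (simp add: c_def)
qed

text \<open>Translation moves any \<open>z\<close> with \<open>m z \<noteq> 0\<close> to the origin,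
  the slack \<open>R = cmod z\<close> of the previous lemma absorbing the shift. So the second
  derivative of \<open>\<psi>\<close> vanishes off the zeros of \<open>m\<close>, and the identity
  theorem extends this to the plane.\<close>

lemma affine_if_exp_growth:
  fixes \<psi> m :: "complex \<Rightarrow> complex"
  assumes \<psi>: "\<psi> holomorphic_on UNIV" and m: "m holomorphic_on UNIV" and m0: "m z0 \<noteq> 0" and C: "0 \<le> C"
    and le: "\<And>z. cmod (m z) * exp ((cmod (\<psi> z))\<^sup>2 / 2) \<le> C * (1 + cmod z) * exp ((cmod z)\<^sup>2 / 2)"
  shows "\<exists>a b. \<psi> = (\<lambda>z. a * z + b)"
proof -
  have shift: "(\<lambda>u. f (z + u)) holomorphic_on UNIV" if "f holomorphic_on UNIV" for f :: "complex \<Rightarrow> complex" and z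
  proof -
    have "(\<lambda>u. z + u) holomorphic_on UNIV" by (intro holomorphic_intros)
    from holomorphic_on_compose_gen[OF this that] show ?thesis by (simp add: o_def)
  qed
  have dshift: "deriv (\<lambda>u. f (z + u)) = (\<lambda>u. deriv f (z + u))" if "f holomorphic_on UNIV" for f :: "complex \<Rightarrow> complex" and z
  proof
    fix u
    have "(f has_field_derivative deriv f (z + u)) (at (z + u))" using that by (simp add: holomorphic_derivI)
    then have "((\<lambda>u. f (z + u)) has_field_derivative deriv f (z + u)) (at u)"
      using DERIV_at_within_shift[of f _ z u UNIV] by simp
    then show "deriv (\<lambda>u. f (z + u)) u = deriv f (z + u)" by (rule DERIV_imp_deriv)
  qed
  have d\<psi>: "deriv \<psi> holomorphic_on UNIV" using \<psi> by (simp add: holomorphic_deriv)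
  have z: "deriv (deriv \<psi>) z = 0" if "m z \<noteq> 0" for z
  proof -
    have "deriv (deriv (\<lambda>u. \<psi> (z + u))) 0 = 0"
    proof (rule second_deriv_zero_if_exp_growth[OF shift[OF \<psi>] shift[OF m]])
      fix u
      have n: "cmod (z + u) \<le> cmod u + cmod z" using norm_triangle_ineq[of u z] by (simp add: add.commute)
      have "cmod (m (z + u)) * exp ((cmod (\<psi> (z + u)))\<^sup>2 / 2) \<le> C * (1 + cmod (z + u)) * exp ((cmod (z + u))\<^sup>2 / 2)"
        by (rule le)
      also have "\<dots> \<le> C * (1 + (cmod u + cmod z)) * exp ((cmod u + cmod z)\<^sup>2 / 2)"
        using n C by (intro mult_mono) (auto intro!: mult_left_mono power_mono divide_right_mono)
      finally show "cmod (m (z + u)) * exp ((cmod (\<psi> (z + u)))\<^sup>2 / 2) \<le> C * (1 + (cmod u + cmod z)) * exp ((cmod u + cmod z)\<^sup>2 / 2)" .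
    qed (use that C in auto)
    then show ?thesis by (simp add: dshift[OF \<psi>] dshift[OF d\<psi>])
  qed
  have "open {z. m z \<noteq> 0}"
    using entire_continuous_on[OF m] by (intro open_Collect_neq continuous_intros)
  then have zz: "deriv (deriv \<psi>) z = 0" for z
    using analytic_continuation_open[of "{z. m z \<noteq> 0}" UNIV "deriv (deriv \<psi>)" "\<lambda>_. 0" z] z m0 d\<psi>
    by (auto intro: holomorphic_deriv)
  have "\<exists>a. \<forall>z\<in>UNIV. deriv \<psi> z = a"
  proof (rule has_field_derivative_zero_constant)
    fix z show "(deriv \<psi> has_field_derivative 0) (at z within UNIV)"
      using holomorphic_derivI[OF d\<psi>, of z] zz by simp
  qed auto
  then obtain a where a: "\<And>z. deriv \<psi> z = a" by auto
  have "\<exists>b. \<forall>z\<in>UNIV. \<psi> z - a * z = b"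
  proof (rule has_field_derivative_zero_constant)
    fix z
    have "(\<psi> has_field_derivative a) (at z)"
      using holomorphic_derivI[OF \<psi>, of z] a by simp
    then show "((\<lambda>z. \<psi> z - a * z) has_field_derivative 0) (at z within UNIV)"
      by (auto intro!: derivative_eq_intros)
  qed auto
  then obtain b where "\<And>z. \<psi> z - a * z = b" by auto
  then have "\<psi> = (\<lambda>z. a * z + b)" by (intro ext) (metis add.commute diff_add_cancel)
  then show ?thesis by blast
qed

subsection \<open>Test functions\<close>

text \<open>The exponential is the normalised reproducing kernel at \<open>w\<close>. Its affine
  factor is expanded around \<open>w\<close>, so bounds on \<open>\<alpha>\<close> and
  \<open>\<beta>\<close> give norm bounds uniform in \<open>w\<close>.\<close>

definition fock_test :: "complex \<Rightarrow> complex \<Rightarrow> complex \<Rightarrow> complex \<Rightarrow> complex" where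
  "fock_test \<alpha> \<beta> w z = (\<alpha> + \<beta> * (z - w)) * exp (cnj w * z - of_real ((cmod w)\<^sup>2 / 2))"

lemma fock_test_holomorphic: "fock_test \<alpha> \<beta> w holomorphic_on UNIV"
  unfolding fock_test_def by (intro holomorphic_intros)

lemma deriv_fock_test:
  "deriv (fock_test \<alpha> \<beta> w) z =
     (\<beta> + cnj w * (\<alpha> + \<beta> * (z - w))) * exp (cnj w * z - of_real ((cmod w)\<^sup>2 / 2))"
  unfolding fock_test_def
  by (rule DERIV_imp_deriv) (auto intro!: derivative_eq_intros simp: algebra_simps)

text \<open>Completing the square shows that the weighted modulus of the kernel is a Gaussian
  centred at \<open>w\<close>.\<close>

lemma cmod_fock_kernel:
  "cmod (exp (cnj w * z - of_real ((cmod w)\<^sup>2 / 2))) = exp ((cmod z)\<^sup>2 / 2 - (cmod (z - w))\<^sup>2 / 2)"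
proof -
  have "Re (cnj w * z) - (cmod w)\<^sup>2 / 2 = (cmod z)\<^sup>2 / 2 - (cmod (z - w))\<^sup>2 / 2"
    unfolding cmod_power2 by (simp add: power2_eq_square field_simps)
  then show ?thesis by (simp add: norm_exp_eq_Re)
qed

text \<open>The weighted modulus depends on \<open>z - w\<close> apart from the affine factor, which
  \<open>exp x\<close> dominates. Translation invariance then removes \<open>w\<close>.\<close>

lemma fock_test_bounded:
  assumes p: "0 < p" and B: "0 \<le> B"
  shows "\<exists>K. \<forall>\<alpha> \<beta> w. cmod \<alpha> \<le> B \<longrightarrow> cmod \<beta> \<le> B \<longrightarrow>
     fock_in p (fock_test \<alpha> \<beta> w) \<and> fock_norm p (fock_test \<alpha> \<beta> w) \<le> K"
proof -
  define G where "G = enn2real (\<integral>\<^sup>+ u. ennreal (exp (- (p/4) * (cmod u)\<^sup>2)) \<partial>lborel)"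
  have G: "(\<integral>\<^sup>+ u. ennreal (exp (- (p/4) * (cmod u)\<^sup>2)) \<partial>lborel) = ennreal G"
    using nn_integral_gaussian_finite[of "p/4"] p unfolding G_def by (simp add: less_top)
  have G0: "0 \<le> G" by (simp add: G_def)
  define K where "K = B powr p * exp p * G"
  have K: "0 \<le> K" using G0 by (simp add: K_def)
  have main: "fock_integral p (fock_test \<alpha> \<beta> w) \<le> ennreal K" if ab: "cmod \<alpha> \<le> B" "cmod \<beta> \<le> B" for \<alpha> \<beta> w
  proof -
    have "fock_integral p (fock_test \<alpha> \<beta> w) \<le> (\<integral>\<^sup>+ z. ennreal (B powr p * exp p) * ennreal (exp (- (p/4) * (cmod (- w + z))\<^sup>2)) \<partial>lborel)"
      unfolding fock_integral_eq
    proof (rule nn_integral_mono)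
      fix z
      define x where "x = cmod (z - w)"
      have x: "0 \<le> x" by (simp add: x_def)
      have "cmod (fock_test \<alpha> \<beta> w z) \<le> B * exp x * exp ((cmod z)\<^sup>2 / 2 - x\<^sup>2 / 2)"
        unfolding fock_test_def norm_mult cmod_fock_kernel x_def[symmetric]
      proof (rule mult_right_mono)
        have "cmod (\<alpha> + \<beta> * (z - w)) \<le> cmod \<alpha> + cmod \<beta> * x"
          unfolding x_def by (metis norm_triangle_ineq norm_mult)
        also have "\<dots> \<le> B + B * x" using ab x by (intro add_mono mult_right_mono) auto
        also have "\<dots> = B * (1 + x)" by (simp add: algebra_simps)
        also have "\<dots> \<le> B * exp x" using B exp_ge_add_one_self[of x] by (intro mult_left_mono) auto
        finally show "cmod (\<alpha> + \<beta> * (z - w)) \<le> B * exp x" .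
      qed auto
      then have "cmod (fock_test \<alpha> \<beta> w z) powr p \<le> (B * exp x * exp ((cmod z)\<^sup>2 / 2 - x\<^sup>2 / 2)) powr p"
        using p by (intro powr_mono2) auto
      also have "\<dots> = B powr p * exp (p * x + p * ((cmod z)\<^sup>2 / 2 - x\<^sup>2 / 2))"
        by (simp add: powr_mult exp_powr_real exp_add mult.commute)
      finally have "fock_wdens 0 p (fock_test \<alpha> \<beta> w) z \<le> B powr p * exp (p * x + p * ((cmod z)\<^sup>2 / 2 - x\<^sup>2 / 2)) * exp (-(p/2) * (cmod z)\<^sup>2)"
        unfolding fock_wdens_def by (auto intro: mult_right_mono)
      also have "\<dots> = B powr p * exp (p * (x - x\<^sup>2 / 2))"
        by (simp add: algebra_simps flip: exp_add)
      also have "\<dots> \<le> B powr p * exp (p + - (p/4) * x\<^sup>2)"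
      proof -
        \<comment> \<open>Half of the Gaussian decay is spent on absorbing the linear term, which
          leaves the rate p/4.\<close>
        have "0 \<le> (x/2 - 1)\<^sup>2" by simp
        then have "x - x\<^sup>2/2 \<le> 1 - x\<^sup>2/4" by (simp add: power2_eq_square field_simps)
        then have "p * (x - x\<^sup>2/2) \<le> p * (1 - x\<^sup>2/4)" using p by (intro mult_left_mono) auto
        then show ?thesis by (intro mult_left_mono) (auto simp: algebra_simps)
      qed
      also have "\<dots> = B powr p * exp p * exp (- (p/4) * (cmod (- w + z))\<^sup>2)"
        unfolding exp_add x_def by simp
      finally show "ennreal (fock_wdens 0 p (fock_test \<alpha> \<beta> w) z) \<le> ennreal (B powr p * exp p) * ennreal (exp (- (p/4) * (cmod (- w + z))\<^sup>2))"
        by (simp flip: ennreal_mult' add: ennreal_leI)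
    qed
    also have "\<dots> = ennreal (B powr p * exp p) * (\<integral>\<^sup>+ z. ennreal (exp (- (p/4) * (cmod (- w + z))\<^sup>2)) \<partial>lborel)"
      by (rule nn_integral_cmult) measurable
    also have "(\<integral>\<^sup>+ z. ennreal (exp (- (p/4) * (cmod (- w + z))\<^sup>2)) \<partial>lborel) = ennreal G"
      unfolding G[symmetric] by (rule nn_integral_lborel_translate) measurable
    also have "ennreal (B powr p * exp p) * ennreal G = ennreal K"
      by (simp add: K_def ennreal_mult')
    finally show ?thesis .
  qed
  have "fock_in p (fock_test \<alpha> \<beta> w) \<and> fock_norm p (fock_test \<alpha> \<beta> w) \<le> (p / (2 * pi) * K) powr (1 / p)"
    if ab: "cmod \<alpha> \<le> B" "cmod \<beta> \<le> B" for \<alpha> \<beta> w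
    using fock_norm_leI[OF p K main[OF ab]] le_less_trans[OF main[OF ab] ennreal_less_top]
    by (simp add: fock_in_def fock_test_holomorphic)
  then show ?thesis by blast
qed

text \<open>At a fixed point the normalising factor decays like a Gaussian in
  \<open>cmod (w n)\<close>, while the kernel grows only exponentially and the remaining factor
  polynomially. One quadratic bound serves both orders of differentiation.\<close>

lemma fock_test_tendsto_zero:
  assumes w: "filterlim (\<lambda>n::nat. cmod (w n)) at_top sequentially"
    and ab: "\<And>n. cmod (\<alpha> n) \<le> B" "\<And>n. cmod (\<beta> n) \<le> B" and i: "i \<le> 1"
  shows "(\<lambda>n. (deriv ^^ i) (fock_test (\<alpha> n) (\<beta> n) (w n)) z) \<longlonglongrightarrow> 0"
proof (rule Lim_null_comparison)
  define c where "c = cmod z"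
  have B: "0 \<le> B" using ab(1)[of 0] norm_ge_zero order_trans by blast
  have "((\<lambda>x. B * (2 + c + x)\<^sup>2 * exp (c * x - x\<^sup>2 / 2)) \<longlongrightarrow> 0) at_top"
    by real_asymp
  from filterlim_compose[OF this w]
  show "(\<lambda>n. B * (2 + c + cmod (w n))\<^sup>2 * exp (c * cmod (w n) - (cmod (w n))\<^sup>2 / 2)) \<longlonglongrightarrow> 0" .
  show "eventually (\<lambda>n. norm ((deriv ^^ i) (fock_test (\<alpha> n) (\<beta> n) (w n)) z) \<le> B * (2 + c + cmod (w n))\<^sup>2 * exp (c * cmod (w n) - (cmod (w n))\<^sup>2 / 2)) sequentially"
  proof (rule always_eventually, rule allI)
    fix n
    define x where "x = cmod (w n)"
    have x: "0 \<le> x" and c: "0 \<le> c" by (auto simp: x_def c_def)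
    have k: "cmod (exp (cnj (w n) * z - of_real ((cmod (w n))\<^sup>2 / 2))) \<le> exp (c * x - x\<^sup>2 / 2)"
      using complex_Re_le_cmod[of "cnj (w n) * z"] by (simp add: norm_exp_eq_Re norm_mult x_def c_def mult.commute)
    have a: "cmod (\<alpha> n + \<beta> n * (z - w n)) \<le> B * (1 + c + x)"
    proof -
      have "cmod (\<alpha> n + \<beta> n * (z - w n)) \<le> cmod (\<alpha> n) + cmod (\<beta> n) * cmod (z - w n)"
        by (metis norm_triangle_ineq norm_mult)
      also have "\<dots> \<le> B + B * (c + x)"
        using ab[of n] B norm_triangle_ineq4[of z "w n"] by (intro add_mono mult_mono) (auto simp: c_def x_def)
      finally show ?thesis by (simp add: algebra_simps)
    qed
    have poly: "cmod (if i = 0 then \<alpha> n + \<beta> n * (z - w n) else \<beta> n + cnj (w n) * (\<alpha> n + \<beta> n * (z - w n))) \<le> B * (2 + c + x)\<^sup>2"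
    proof (cases "i = 0")
      case True
      have "B * (1 + c + x) \<le> B * (2 + c + x)\<^sup>2"
        using B x c by (intro mult_left_mono) (auto simp: power2_eq_square algebra_simps intro!: add_nonneg_nonneg)
      then show ?thesis using a True by simp
    next
      case False
      have "cmod (\<beta> n + cnj (w n) * (\<alpha> n + \<beta> n * (z - w n))) \<le> cmod (\<beta> n) + x * cmod (\<alpha> n + \<beta> n * (z - w n))"
        unfolding x_def by (metis norm_triangle_ineq norm_mult complex_mod_cnj)
      also have "\<dots> \<le> B + x * (B * (1 + c + x))"
        using ab[of n] a x by (intro add_mono mult_left_mono) auto
      also have "\<dots> = B * (1 + x * (1 + c + x))" by (simp add: algebra_simps)
      also have "\<dots> \<le> B * (2 + c + x)\<^sup>2"
        using B x c by (intro mult_left_mono) (auto simp: power2_eq_square algebra_simps intro!: add_nonneg_nonneg)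
      finally show ?thesis using False by simp
    qed
    have "(deriv ^^ i) (fock_test (\<alpha> n) (\<beta> n) (w n)) z = (if i = 0 then \<alpha> n + \<beta> n * (z - w n) else \<beta> n + cnj (w n) * (\<alpha> n + \<beta> n * (z - w n))) * exp (cnj (w n) * z - of_real ((cmod (w n))\<^sup>2 / 2))"
      using i by (cases i) (auto simp: fock_test_def deriv_fock_test)
    then show "norm ((deriv ^^ i) (fock_test (\<alpha> n) (\<beta> n) (w n)) z) \<le> B * (2 + c + cmod (w n))\<^sup>2 * exp (c * cmod (w n) - (cmod (w n))\<^sup>2 / 2)"
      using mult_mono[OF poly k] B by (simp add: norm_mult x_def)
  qed
qed

subsection \<open>The operators\<close>

definition fock_op ::
  "nat \<Rightarrow> (complex \<Rightarrow> complex) \<Rightarrow> (complex \<Rightarrow> complex) \<Rightarrow> (complex \<Rightarrow> complex) \<Rightarrow> complex \<Rightarrow> complex" where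
  "fock_op i m \<psi> f z = contour_integral (linepath 0 z) (\<lambda>w. (deriv ^^ i) f (\<psi> w) * m w)"

definition fock_symbol :: "nat \<Rightarrow> (complex \<Rightarrow> complex) \<Rightarrow> (complex \<Rightarrow> complex) \<Rightarrow> complex \<Rightarrow> real" where
  "fock_symbol i m \<psi> z =
     cmod (m z) * (1 + cmod (\<psi> z)) ^ i / (1 + cmod z) * exp ((cmod (\<psi> z)^2 - cmod z^2) / 2)"

lemma Vop_eq_fock_op: "Vop g \<psi> = fock_op 0 (deriv g) \<psi>"
  by (intro ext) (simp add: Vop_def fock_op_def)

lemma Jop_eq_fock_op: "Jop g \<psi> = fock_op 1 g \<psi>"
  by (intro ext) (simp add: Jop_def fock_op_def)

lemma Mfun_eq_fock_symbol: "Mfun g \<psi> = fock_symbol 0 (deriv g) \<psi>"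
  by (intro ext) (simp add: Mfun_def fock_symbol_def)

lemma Mtfun_eq_fock_symbol: "Mtfun g \<psi> = fock_symbol 1 g \<psi>"
  by (intro ext) (simp add: Mtfun_def fock_symbol_def)

lemma fock_symbol_nonneg [simp]: "0 \<le> fock_symbol i m \<psi> z"
  by (simp add: fock_symbol_def)

text \<open>The integrand is entire and so has a primitive \<open>G\<close> on the plane. The
  operator is \<open>G z - G 0\<close>, from which all four facts are read off.\<close>

lemma
  assumes m: "m holomorphic_on UNIV" and \<psi>: "\<psi> holomorphic_on UNIV" and f: "f holomorphic_on UNIV"
  shows has_contour_integral_fock_op:
      "((\<lambda>w. (deriv ^^ i) f (\<psi> w) * m w) has_contour_integral fock_op i m \<psi> f z) (linepath 0 z)"
    and holomorphic_fock_op: "fock_op i m \<psi> f holomorphic_on UNIV"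
    and fock_op_0: "fock_op i m \<psi> f 0 = 0"
    and deriv_fock_op: "deriv (fock_op i m \<psi> f) z = (deriv ^^ i) f (\<psi> z) * m z"
proof -
  define I where "I = (\<lambda>w. (deriv ^^ i) f (\<psi> w) * m w)"
  have "((deriv ^^ i) f \<circ> \<psi>) holomorphic_on UNIV"
    by (rule holomorphic_on_compose_gen[OF \<psi> holomorphic_deriv_funpow[OF f]]) simp
  then have I: "I holomorphic_on UNIV"
    unfolding I_def using m by (auto simp: o_def intro: holomorphic_on_mult)
  obtain G where G: "\<And>x. x \<in> UNIV \<Longrightarrow> (G has_field_derivative I x) (at x within UNIV)"
    using holomorphic_convex_primitive'[OF convex_UNIV open_UNIV I] by blast
  have hc: "(I has_contour_integral (G z - G 0)) (linepath 0 z)" for z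
    using contour_integral_primitive[OF G, of "linepath 0 z"] by simp
  have eq: "fock_op i m \<psi> f = (\<lambda>z. G z - G 0)"
    using contour_integral_unique[OF hc] by (intro ext) (simp add: fock_op_def I_def)
  show "((\<lambda>w. (deriv ^^ i) f (\<psi> w) * m w) has_contour_integral fock_op i m \<psi> f z) (linepath 0 z)"
    using hc[of z] by (simp add: eq I_def)
  show "fock_op i m \<psi> f 0 = 0" by (simp add: eq)
  have d: "(fock_op i m \<psi> f has_field_derivative I z) (at z)" for z
    unfolding eq using G[of z] by (auto intro!: derivative_eq_intros)
  then show "fock_op i m \<psi> f holomorphic_on UNIV"
    by (auto simp: holomorphic_on_def field_differentiable_def)
  show "deriv (fock_op i m \<psi> f) z = (deriv ^^ i) f (\<psi> z) * m z"
    using DERIV_imp_deriv[OF d] by (simp add: I_def)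
qed

lemma deriv_funpow_diff:
  assumes "f holomorphic_on UNIV" "g holomorphic_on UNIV"
  shows "(deriv ^^ i) (\<lambda>z. f z - g z) z = (deriv ^^ i) f z - (deriv ^^ i) g z"
  using higher_deriv_diff[OF assms, of z i] by simp

lemma fock_op_diff:
  assumes m: "m holomorphic_on UNIV" and \<psi>: "\<psi> holomorphic_on UNIV"
    and f: "f holomorphic_on UNIV" and g: "g holomorphic_on UNIV"
  shows "fock_op i m \<psi> (\<lambda>z. f z - g z) z = fock_op i m \<psi> f z - fock_op i m \<psi> g z"
  using contour_integral_unique[OF has_contour_integral_diff[OF has_contour_integral_fock_op[OF m \<psi> f, of i z]
        has_contour_integral_fock_op[OF m \<psi> g, of i z]]]
  by (simp add: fock_op_def deriv_funpow_diff[OF f g] left_diff_distrib)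

lemma fock_op_weight_diff:
  assumes m: "m holomorphic_on UNIV" and n: "n holomorphic_on UNIV" and \<psi>: "\<psi> holomorphic_on UNIV"
    and f: "f holomorphic_on UNIV"
  shows "fock_op i (\<lambda>z. m z - n z) \<psi> f z = fock_op i m \<psi> f z - fock_op i n \<psi> f z"
  using contour_integral_unique[OF has_contour_integral_diff[OF has_contour_integral_fock_op[OF m \<psi> f, of i z]
        has_contour_integral_fock_op[OF n \<psi> f, of i z]]]
  by (simp add: fock_op_def right_diff_distrib)

text \<open>This identity explains the form of the symbol: its exponential trades the Gaussian
  weight at \<open>z\<close> for the one at \<open>\<psi> z\<close>, and its polynomial factors
  trade the two derivative weights.\<close>

lemma fock_wdens_fock_op:
  assumes m: "m holomorphic_on UNIV" and \<psi>: "\<psi> holomorphic_on UNIV" and f: "f holomorphic_on UNIV"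
  shows "fock_wdens 1 q (fock_op i m \<psi> f) z = fock_symbol i m \<psi> z powr q * fock_wdens i q f (\<psi> z)"
proof -
  define D x y where "D = cmod ((deriv ^^ i) f (\<psi> z))" and "x = 1 + cmod z" and "y = (1 + cmod (\<psi> z)) ^ i"
  have xy: "0 < x" "0 < y" by (auto simp: x_def y_def add_pos_nonneg)
  have D: "0 \<le> D" by (simp add: D_def)
  have "fock_wdens 1 q (fock_op i m \<psi> f) z = (D * cmod (m z) / x) powr q * exp (-(q/2) * (cmod z)\<^sup>2)"
    by (simp add: fock_wdens_def deriv_fock_op[OF m \<psi> f] norm_mult D_def x_def)
  also have "D * cmod (m z) / x = (cmod (m z) * y / x) * (D / y)" using xy by simp
  also have "\<dots> powr q = (cmod (m z) * y / x) powr q * (D / y) powr q" by (rule powr_mult)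
  also have "exp (-(q/2) * (cmod z)\<^sup>2) = exp ((cmod (\<psi> z)^2 - cmod z^2) / 2) powr q * exp (-(q/2) * (cmod (\<psi> z))\<^sup>2)"
    by (simp add: exp_powr_real field_simps flip: exp_add)
  also have "(cmod (m z) * y / x) powr q * (D / y) powr q * (exp ((cmod (\<psi> z)^2 - cmod z^2) / 2) powr q * exp (-(q/2) * (cmod (\<psi> z))\<^sup>2))
     = (cmod (m z) * y / x * exp ((cmod (\<psi> z)^2 - cmod z^2) / 2)) powr q * ((D / y) powr q * exp (-(q/2) * (cmod (\<psi> z))\<^sup>2))"
    by (simp only: powr_mult mult_ac)
  finally show ?thesis by (simp add: fock_symbol_def fock_wdens_def D_def x_def y_def)
qed

text \<open>The plane is split at radius \<open>R\<close>: outside, the symbol is small and the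
  affine substitution applies; inside, \<open>m\<close> is bounded by compactness. The order of
  quantifiers is essential: \<open>K\<close> is independent of \<open>R\<close>, and
  \<open>A\<close> depends on \<open>R\<close> but not on \<open>f\<close>,
  \<open>\<epsilon>\<close> or \<open>\<delta>\<close>.\<close>

lemma fock_op_integral_le:
  assumes q: "0 < q" and i: "i \<le> 1" and a: "a \<noteq> 0" and \<psi>: "\<psi> = (\<lambda>z. a * z + b)" and m: "m holomorphic_on UNIV"
  shows "\<exists>K>0. \<forall>R\<ge>0. \<exists>A\<ge>0. \<forall>f \<epsilon> \<delta>. f holomorphic_on UNIV \<longrightarrow> 0 \<le> \<epsilon> \<longrightarrow> 0 \<le> \<delta> \<longrightarrow>
      (\<forall>z. R \<le> cmod z \<longrightarrow> fock_symbol i m \<psi> z \<le> \<epsilon>) \<longrightarrow>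
      (\<forall>z. cmod z \<le> R \<longrightarrow> cmod ((deriv ^^ i) f (\<psi> z)) \<le> \<delta>) \<longrightarrow>
      fock_integral q (fock_op i m \<psi> f) \<le> ennreal (K * \<epsilon> powr q) * fock_integral q f + ennreal (A * \<delta> powr q)"
proof -
  obtain C1 where C1: "0 < C1" and lp: "\<And>F. F holomorphic_on UNIV \<Longrightarrow> F 0 = 0 \<Longrightarrow>
     fock_integral q F \<le> ennreal C1 * (\<integral>\<^sup>+ z. ennreal (fock_wdens 1 q F z) \<partial>lborel)"
    using fock_integral_le_deriv[OF q] by metis
  obtain C2 where C2: "0 < C2" and af: "\<And>f i. f holomorphic_on UNIV \<Longrightarrow> i \<le> 1 \<Longrightarrow>
     (\<integral>\<^sup>+ z. ennreal (fock_wdens i q f (a * z + b)) \<partial>lborel) \<le> ennreal C2 * fock_integral q f"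
    using fock_wdens_affine_le[OF q a] by metis
  have \<psi>h: "\<psi> holomorphic_on UNIV" unfolding \<psi> by (intro holomorphic_intros)
  have "\<exists>A\<ge>0. \<forall>f \<epsilon> \<delta>. f holomorphic_on UNIV \<longrightarrow> 0 \<le> \<epsilon> \<longrightarrow> 0 \<le> \<delta> \<longrightarrow>
      (\<forall>z. R \<le> cmod z \<longrightarrow> fock_symbol i m \<psi> z \<le> \<epsilon>) \<longrightarrow>
      (\<forall>z. cmod z \<le> R \<longrightarrow> cmod ((deriv ^^ i) f (\<psi> z)) \<le> \<delta>) \<longrightarrow>
      fock_integral q (fock_op i m \<psi> f) \<le> ennreal (C1 * C2 * \<epsilon> powr q) * fock_integral q f + ennreal (A * \<delta> powr q)"
    if R: "0 \<le> R" for R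
  proof -
    have "bounded (m ` cball 0 R)"
      by (intro compact_imp_bounded compact_continuous_image entire_continuous_on m) auto
    then obtain M where M: "0 < M" "\<And>z. cmod z \<le> R \<Longrightarrow> cmod (m z) \<le> M"
      by (auto simp: bounded_pos)
    \<comment> \<open>The open ball of radius \<open>R + 1\<close> covers the closed disc of radius
      \<open>R\<close>, and its area enters here.\<close>
    define A where "A = C1 * (M powr q * (pi * (R + 1)\<^sup>2))"
    have A: "0 \<le> A" using C1 by (simp add: A_def)
    have "fock_integral q (fock_op i m \<psi> f) \<le> ennreal (C1 * C2 * \<epsilon> powr q) * fock_integral q f + ennreal (A * \<delta> powr q)"
      if f: "f holomorphic_on UNIV" and \<epsilon>: "0 \<le> \<epsilon>" and \<delta>: "0 \<le> \<delta>"
        and far: "\<And>z. R \<le> cmod z \<Longrightarrow> fock_symbol i m \<psi> z \<le> \<epsilon>"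
        and near: "\<And>z. cmod z \<le> R \<Longrightarrow> cmod ((deriv ^^ i) f (\<psi> z)) \<le> \<delta>" for f \<epsilon> \<delta>
    proof -
      note [measurable] = fock_wdens_measurable[OF f]
      have "(\<integral>\<^sup>+ z. ennreal (fock_wdens 1 q (fock_op i m \<psi> f) z) \<partial>lborel) \<le>
         (\<integral>\<^sup>+ z. ennreal (\<epsilon> powr q) * ennreal (fock_wdens i q f (a * z + b)) + ennreal ((\<delta> * M) powr q) * indicator (ball 0 (R + 1)) z \<partial>lborel)"
      proof (rule nn_integral_mono)
        fix z
        show "ennreal (fock_wdens 1 q (fock_op i m \<psi> f) z) \<le> ennreal (\<epsilon> powr q) * ennreal (fock_wdens i q f (a * z + b)) + ennreal ((\<delta> * M) powr q) * indicator (ball 0 (R + 1)) z"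
        proof (cases "R \<le> cmod z")
          case True
          then have "fock_symbol i m \<psi> z powr q \<le> \<epsilon> powr q"
            using far q by (intro powr_mono2) auto
          then have "fock_wdens 1 q (fock_op i m \<psi> f) z \<le> \<epsilon> powr q * fock_wdens i q f (\<psi> z)"
            unfolding fock_wdens_fock_op[OF m \<psi>h f] by (intro mult_right_mono) auto
          then have "ennreal (fock_wdens 1 q (fock_op i m \<psi> f) z) \<le> ennreal (\<epsilon> powr q) * ennreal (fock_wdens i q f (a * z + b))"
            by (simp add: \<psi> ennreal_leI flip: ennreal_mult')
          then show ?thesis by (rule order_trans) simp
        next
          case False
          then have z: "cmod z \<le> R" by simp
          have "cmod ((deriv ^^ i) f (\<psi> z)) * cmod (m z) / (1 + cmod z) \<le> \<delta> * M / 1"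
            using near[OF z] M(2)[OF z] M(1) \<delta> by (intro frac_le mult_mono mult_nonneg_nonneg) auto
          then have "(cmod ((deriv ^^ i) f (\<psi> z)) * cmod (m z) / (1 + cmod z)) powr q \<le> (\<delta> * M) powr q"
            using q by (intro powr_mono2) auto
          moreover have "exp (-(q/2) * (cmod z)\<^sup>2) \<le> 1" using q by simp
          ultimately have "(cmod ((deriv ^^ i) f (\<psi> z)) * cmod (m z) / (1 + cmod z)) powr q * exp (-(q/2) * (cmod z)\<^sup>2) \<le> (\<delta> * M) powr q * 1"
            by (intro mult_mono) auto
          then have "fock_wdens 1 q (fock_op i m \<psi> f) z \<le> (\<delta> * M) powr q"
            by (simp add: fock_wdens_def deriv_fock_op[OF m \<psi>h f] norm_mult)
          then have "ennreal (fock_wdens 1 q (fock_op i m \<psi> f) z) \<le> ennreal ((\<delta> * M) powr q) * indicator (ball 0 (R + 1)) z"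
            using z by (simp add: indicator_def ennreal_leI)
          then show ?thesis by (rule order_trans) simp
        qed
      qed
      also have "\<dots> = ennreal (\<epsilon> powr q) * (\<integral>\<^sup>+ z. ennreal (fock_wdens i q f (a * z + b)) \<partial>lborel) + ennreal ((\<delta> * M) powr q) * ennreal (pi * (R + 1)\<^sup>2)"
        using R by (subst nn_integral_add) (auto simp: nn_integral_cmult nn_integral_cmult_indicator emeasure_ball_complex)
      also have "\<dots> \<le> ennreal (\<epsilon> powr q) * (ennreal C2 * fock_integral q f) + ennreal ((\<delta> * M) powr q) * ennreal (pi * (R + 1)\<^sup>2)"
        by (intro add_right_mono mult_left_mono af[OF f i]) auto
      finally have le: "(\<integral>\<^sup>+ z. ennreal (fock_wdens 1 q (fock_op i m \<psi> f) z) \<partial>lborel) \<le>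
         ennreal (\<epsilon> powr q) * (ennreal C2 * fock_integral q f) + ennreal ((\<delta> * M) powr q) * ennreal (pi * (R + 1)\<^sup>2)" .
      have "fock_integral q (fock_op i m \<psi> f) \<le> ennreal C1 * (\<integral>\<^sup>+ z. ennreal (fock_wdens 1 q (fock_op i m \<psi> f) z) \<partial>lborel)"
        by (intro lp holomorphic_fock_op[OF m \<psi>h f] fock_op_0[OF m \<psi>h f])
      also have "\<dots> \<le> ennreal C1 * (ennreal (\<epsilon> powr q) * (ennreal C2 * fock_integral q f) + ennreal ((\<delta> * M) powr q) * ennreal (pi * (R + 1)\<^sup>2))"
        using le by (intro mult_left_mono) auto
      also have "\<dots> = ennreal C1 * ennreal C2 * ennreal (\<epsilon> powr q) * fock_integral q f + ennreal C1 * (ennreal ((\<delta> * M) powr q) * ennreal (pi * (R + 1)\<^sup>2))"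
        by (simp add: distrib_left mult_ac)
      also have "ennreal C1 * ennreal C2 * ennreal (\<epsilon> powr q) = ennreal (C1 * C2 * \<epsilon> powr q)"
        using C1 C2 by (simp add: ennreal_mult)
      also have "ennreal C1 * (ennreal ((\<delta> * M) powr q) * ennreal (pi * (R + 1)\<^sup>2)) = ennreal (C1 * ((\<delta> * M) powr q * (pi * (R + 1)\<^sup>2)))"
        using C1 by (simp add: ennreal_mult)
      also have "C1 * ((\<delta> * M) powr q * (pi * (R + 1)\<^sup>2)) = A * \<delta> powr q"
        by (simp add: A_def powr_mult mult_ac)
      finally show ?thesis .
    qed
    then show ?thesis using A by blast
  qed
  moreover have "0 < C1 * C2" using C1 C2 by simp
  ultimately show ?thesis by blast
qed

text \<open>The split estimate is used with \<open>\<epsilon> = 1\<close> and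
  \<open>\<delta>\<close> a bound on a compact disc. Membership comes from the symbol alone because
  the compactness criterion is also applied to the weight difference \<open>m - n\<close>.\<close>

lemma fock_in_fock_op:
  assumes p: "0 < p" and pq: "p \<le> q" and i: "i \<le> 1" and a: "a \<noteq> 0" and \<psi>: "\<psi> = (\<lambda>z. a * z + b)" and m: "m holomorphic_on UNIV"
    and lim: "(fock_symbol i m \<psi> \<longlongrightarrow> 0) at_infinity" and f: "fock_in p f"
  shows "fock_in q (fock_op i m \<psi> f)"
proof -
  have q: "0 < q" using p pq by simp
  have \<psi>h: "\<psi> holomorphic_on UNIV" unfolding \<psi> by (intro holomorphic_intros)
  have fh: "f holomorphic_on UNIV" using f by (simp add: fock_in_def)
  have fq: "fock_integral q f < \<infinity>" using fock_embedding[OF p pq] f by (auto simp: fock_in_def)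
  obtain b0 where b0: "\<And>z. b0 \<le> cmod z \<Longrightarrow> fock_symbol i m \<psi> z \<le> 1"
    using lim[unfolded Lim_at_infinity, rule_format, of 1] by (auto simp: dist_norm abs_le_iff) (meson less_imp_le abs_ge_self order_le_less_trans)
  define R where "R = max 0 b0"
  have "bounded (((deriv ^^ i) f \<circ> \<psi>) ` cball 0 R)"
    by (intro compact_imp_bounded compact_continuous_image entire_continuous_on holomorphic_on_compose_gen[OF \<psi>h holomorphic_deriv_funpow[OF fh]]) auto
  then obtain M where M: "0 < M" "\<And>z. cmod z \<le> R \<Longrightarrow> cmod ((deriv ^^ i) f (\<psi> z)) \<le> M"
    by (auto simp: bounded_pos)
  obtain K A where "0 \<le> A" "fock_integral q (fock_op i m \<psi> f) \<le> ennreal (K * 1 powr q) * fock_integral q f + ennreal (A * M powr q)"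
  proof -
    obtain K where K: "\<forall>R\<ge>0. \<exists>A\<ge>0. \<forall>f \<epsilon> \<delta>. f holomorphic_on UNIV \<longrightarrow> 0 \<le> \<epsilon> \<longrightarrow> 0 \<le> \<delta> \<longrightarrow>
      (\<forall>z. R \<le> cmod z \<longrightarrow> fock_symbol i m \<psi> z \<le> \<epsilon>) \<longrightarrow>
      (\<forall>z. cmod z \<le> R \<longrightarrow> cmod ((deriv ^^ i) f (\<psi> z)) \<le> \<delta>) \<longrightarrow>
      fock_integral q (fock_op i m \<psi> f) \<le> ennreal (K * \<epsilon> powr q) * fock_integral q f + ennreal (A * \<delta> powr q)"
      using fock_op_integral_le[OF q i a \<psi> m] by blast
    have "0 \<le> R" by (simp add: R_def)
    with K obtain A where A: "0 \<le> A" "\<forall>f \<epsilon> \<delta>. f holomorphic_on UNIV \<longrightarrow> 0 \<le> \<epsilon> \<longrightarrow> 0 \<le> \<delta> \<longrightarrow>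
      (\<forall>z. R \<le> cmod z \<longrightarrow> fock_symbol i m \<psi> z \<le> \<epsilon>) \<longrightarrow>
      (\<forall>z. cmod z \<le> R \<longrightarrow> cmod ((deriv ^^ i) f (\<psi> z)) \<le> \<delta>) \<longrightarrow>
      fock_integral q (fock_op i m \<psi> f) \<le> ennreal (K * \<epsilon> powr q) * fock_integral q f + ennreal (A * \<delta> powr q)"
      by blast
    from A(2)[rule_format, OF fh, of 1 M] M b0 show ?thesis
      by (intro that[OF A(1)]) (auto simp: R_def)
  qed
  note this(2)
  also have "ennreal (K * 1 powr q) * fock_integral q f + ennreal (A * M powr q) < \<infinity>"
    using fq by (simp add: ennreal_mult_less_top)
  finally show ?thesis using holomorphic_fock_op[OF m \<psi>h fh] by (simp add: fock_in_def)
qed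

subsection \<open>Compactness\<close>

lemma ennreal_tendsto_zeroI:
  fixes u :: "nat \<Rightarrow> ennreal"
  assumes "\<And>e. 0 < e \<Longrightarrow> eventually (\<lambda>n. u n \<le> ennreal e) sequentially"
  shows "u \<longlonglongrightarrow> 0"
proof (rule order_tendstoI)
  fix a :: ennreal assume "0 < a"
  then obtain x where x: "0 < x" "x < a" using dense by blast
  then obtain e where e: "0 \<le> e" "x = ennreal e" by (cases x) auto
  then have "0 < e" using x by (simp add: ennreal_less_zero_iff)
  then have "eventually (\<lambda>n. u n \<le> ennreal e) sequentially" by (rule assms)
  then show "eventually (\<lambda>n. u n < a) sequentially"
    by eventually_elim (use x e in auto)
qed auto

text \<open>Fatou's lemma for the densities. It places the limit supplied by Montel's theorem in the
  Fock space.\<close>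

lemma fock_integral_liminf:
  assumes f: "\<And>n. f n holomorphic_on UNIV" and lim: "\<And>z. (\<lambda>n. f n z) \<longlonglongrightarrow> g z"
    and p: "0 < p" and le: "\<And>n. fock_integral p (f n) \<le> K"
  shows "fock_integral p g \<le> K"
proof -
  have "fock_integral p g = (\<integral>\<^sup>+ z. liminf (\<lambda>n. ennreal (fock_wdens 0 p (f n) z)) \<partial>lborel)"
    unfolding fock_integral_eq
  proof (rule nn_integral_cong)
    fix z
    have "(\<lambda>n. fock_wdens 0 p (f n) z) \<longlonglongrightarrow> fock_wdens 0 p g z"
      unfolding fock_wdens_def using p lim[of z]
      by (auto intro!: tendsto_intros tendsto_powr')
    then have "(\<lambda>n. ennreal (fock_wdens 0 p (f n) z)) \<longlonglongrightarrow> ennreal (fock_wdens 0 p g z)"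
      by (rule tendsto_ennrealI)
    then show "ennreal (fock_wdens 0 p g z) = liminf (\<lambda>n. ennreal (fock_wdens 0 p (f n) z))"
      by (rule lim_imp_Liminf[OF sequentially_bot, symmetric])
  qed
  also have "\<dots> \<le> liminf (\<lambda>n. \<integral>\<^sup>+ z. ennreal (fock_wdens 0 p (f n) z) \<partial>lborel)"
    by (rule nn_integral_liminf) (use fock_wdens_measurable[OF f] in auto)
  also have "\<dots> \<le> K"
    unfolding fock_integral_eq[symmetric] using le
    by (intro Liminf_le) auto
  finally show ?thesis .
qed

text \<open>Montel gives a locally uniform limit \<open>f\<close> of a subsequence, and the
  differences \<open>h n\<close> stay bounded in the q-integral. The split estimate then sends their
  images to 0: far away the symbol is small, nearby \<open>h n\<close> and its derivative
  are.\<close>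

lemma fock_op_compact:
  assumes p: "0 < p" and pq: "p \<le> q" and i: "i \<le> 1" and a: "a \<noteq> 0" and \<psi>: "\<psi> = (\<lambda>z. a * z + b)" and m: "m holomorphic_on UNIV"
    and lim: "(fock_symbol i m \<psi> \<longlongrightarrow> 0) at_infinity"
  shows "fock_compact_op p q (fock_op i m \<psi>)"
  unfolding fock_compact_op_def
proof (intro allI impI)
  fix fs :: "nat \<Rightarrow> complex \<Rightarrow> complex"
  assume "(\<forall>n. fock_in p (fs n)) \<and> (\<exists>B. \<forall>n. fock_norm p (fs n) \<le> B)"
  then obtain B where fs: "\<And>n. fock_in p (fs n)" and B: "\<And>n. fock_norm p (fs n) \<le> B" by auto
  have q: "0 < q" using p pq by simp
  have \<psi>h: "\<psi> holomorphic_on UNIV" unfolding \<psi> by (intro holomorphic_intros)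
  have fsh: "fs n holomorphic_on UNIV" for n using fs by (simp add: fock_in_def)
  have B0: "0 \<le> B" using B[of 0] fock_norm_nonneg[of p "fs 0"] by linarith
  obtain C where C: "0 < C" and pt: "\<And>f z i. fock_in p f \<Longrightarrow> i \<le> 1 \<Longrightarrow>
     cmod ((deriv ^^ i) f z) \<le> C * (1 + cmod z) ^ i * exp ((cmod z)\<^sup>2 / 2) * fock_norm p f"
    using fock_pointwise[OF p] by metis
  obtain f r where fh: "f holomorphic_on UNIV" and r: "strict_mono (r :: nat \<Rightarrow> nat)"
    and ptlim: "\<And>x. (\<lambda>n. fs (r n) x) \<longlonglongrightarrow> f x"
    and ulim: "\<And>K. compact K \<Longrightarrow> uniform_limit K (fs \<circ> r) f sequentially"
  proof (rule Montel[of UNIV "range fs" fs])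
    fix K :: "complex set" assume "compact K"
    then have "bounded K" by (rule compact_imp_bounded)
    then obtain M where M: "0 < M" "\<And>z. z \<in> K \<Longrightarrow> cmod z \<le> M" by (auto simp: bounded_pos)
    have "cmod (fs n z) \<le> C * exp (M\<^sup>2 / 2) * B" if "z \<in> K" for n z
    proof -
      have "cmod (fs n z) \<le> C * exp ((cmod z)\<^sup>2 / 2) * fock_norm p (fs n)" using pt[OF fs[of n], of 0 z] by simp
      also have "\<dots> \<le> C * exp (M\<^sup>2 / 2) * B"
        using C B[of n] M(2)[OF that] by (intro mult_mono) (auto intro!: power_mono divide_right_mono)
      finally show ?thesis .
    qed
    then show "\<exists>B. \<forall>h\<in>range fs. \<forall>z\<in>K. cmod (h z) \<le> B" by blast
  qed (use fsh in auto)
  define K0 where "K0 = 2 * pi / p * B powr p"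
  have K0: "0 \<le> K0" using p by (simp add: K0_def)
  have fsK: "fock_integral p (fs n) \<le> ennreal K0" for n
    unfolding fock_integral_fock_norm[OF p fs] K0_def
    using p B[of n] by (intro ennreal_leI mult_left_mono powr_mono2) auto
  have fK: "fock_integral p f \<le> ennreal K0"
    by (rule fock_integral_liminf[OF fsh ptlim p fsK])
  then have fin: "fock_in p f" using fh le_less_trans[OF fK ennreal_less_top] by (simp add: fock_in_def)
  define h where "h = (\<lambda>n z. fs (r n) z - f z)"
  have hin: "fock_in p (h n)" for n unfolding h_def by (intro fock_in_diff p fs fin)
  have hh: "h n holomorphic_on UNIV" for n using hin by (simp add: fock_in_def)
  define K1 where "K1 = 2 powr p * (K0 + K0)"
  have K1: "0 \<le> K1" using K0 by (simp add: K1_def)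
  have "fock_integral p (h n) \<le> ennreal K1" for n
  proof -
    have "fock_integral p (h n) \<le> ennreal (2 powr p) * (fock_integral p (fs (r n)) + fock_integral p f)"
      unfolding h_def by (rule fock_integral_diff_le[OF p fsh fh])
    also have "\<dots> \<le> ennreal (2 powr p) * (ennreal K0 + ennreal K0)"
      by (intro mult_left_mono add_mono fsK fK) auto
    also have "\<dots> = ennreal K1" using K0 by (simp add: K1_def flip: ennreal_plus ennreal_mult')
    finally show ?thesis .
  qed
  then have hn: "fock_norm p (h n) \<le> (p / (2 * pi) * K1) powr (1 / p)" for n
    by (rule fock_norm_leI[OF p K1])
  obtain C2 where C2: "0 \<le> C2" and emb: "\<And>f. fock_in p f \<Longrightarrow> fock_in q f \<and> fock_integral q f \<le> ennreal (C2 * fock_norm p f powr q)"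
    using fock_embedding[OF p pq] by metis
  define E where "E = C2 * ((p / (2 * pi) * K1) powr (1 / p)) powr q"
  have E: "0 \<le> E" using C2 by (simp add: E_def)
  have hE: "fock_integral q (h n) \<le> ennreal E" for n
  proof -
    have "fock_integral q (h n) \<le> ennreal (C2 * fock_norm p (h n) powr q)" using emb[OF hin] by blast
    also have "\<dots> \<le> ennreal E" unfolding E_def
      using q C2 hn[of n] by (intro ennreal_leI mult_left_mono powr_mono2) auto
    finally show ?thesis .
  qed
  obtain K where K: "0 < K" and bnd: "\<And>R. R \<ge> 0 \<Longrightarrow> \<exists>A\<ge>0. \<forall>f \<epsilon> \<delta>. f holomorphic_on UNIV \<longrightarrow> 0 \<le> \<epsilon> \<longrightarrow> 0 \<le> \<delta> \<longrightarrow>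
      (\<forall>z. R \<le> cmod z \<longrightarrow> fock_symbol i m \<psi> z \<le> \<epsilon>) \<longrightarrow>
      (\<forall>z. cmod z \<le> R \<longrightarrow> cmod ((deriv ^^ i) f (\<psi> z)) \<le> \<delta>) \<longrightarrow>
      fock_integral q (fock_op i m \<psi> f) \<le> ennreal (K * \<epsilon> powr q) * fock_integral q f + ennreal (A * \<delta> powr q)"
    using fock_op_integral_le[OF q i a \<psi> m] by blast
  have "(\<lambda>n. fock_integral q (fock_op i m \<psi> (h n))) \<longlonglongrightarrow> 0"
  proof (rule ennreal_tendsto_zeroI)
    fix e :: real assume e: "0 < e"
    \<comment> \<open>The choices are made in the order \<open>\<epsilon>\<close>, \<open>R\<close>,
      \<open>A\<close>, \<open>\<delta>\<close>, each of the two terms receiving \<open>e/2\<close>.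
      Writing \<open>E + 1\<close> avoids division by zero.\<close>
    define \<epsilon> where "\<epsilon> = (e / (2 * K * (E + 1))) powr (1/q)"
    have \<epsilon>: "0 < \<epsilon>" using e K E by (simp add: \<epsilon>_def)
    have \<epsilon>E: "K * \<epsilon> powr q * E \<le> e/2"
    proof -
      have "\<epsilon> powr q = e / (2 * K * (E + 1))" using q e K E by (simp add: \<epsilon>_def powr_powr)
      moreover have "E + 1 \<noteq> 0" using E by simp
      ultimately have "K * \<epsilon> powr q * E = e/2 * (E / (E + 1))" using K by simp
      also have "\<dots> \<le> e/2 * 1" using e E by (intro mult_left_mono) auto
      finally show ?thesis by simp
    qed
    obtain b0 where b0: "\<And>z. b0 \<le> cmod z \<Longrightarrow> dist (fock_symbol i m \<psi> z) 0 < \<epsilon>"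
      using lim[unfolded Lim_at_infinity, rule_format, OF \<epsilon>] by blast
    define R where "R = max 0 b0"
    have R: "0 \<le> R" by (simp add: R_def)
    have far: "\<forall>z. R \<le> cmod z \<longrightarrow> fock_symbol i m \<psi> z \<le> \<epsilon>"
    proof (intro allI impI)
      fix z assume "R \<le> cmod z"
      then show "fock_symbol i m \<psi> z \<le> \<epsilon>" using b0[of z] by (simp add: R_def dist_norm)
    qed
    obtain A where A: "0 \<le> A" and bnd': "\<And>f \<epsilon> \<delta>. f holomorphic_on UNIV \<Longrightarrow> 0 \<le> \<epsilon> \<Longrightarrow> 0 \<le> \<delta> \<Longrightarrow>
      (\<forall>z. R \<le> cmod z \<longrightarrow> fock_symbol i m \<psi> z \<le> \<epsilon>) \<Longrightarrow>
      (\<forall>z. cmod z \<le> R \<longrightarrow> cmod ((deriv ^^ i) f (\<psi> z)) \<le> \<delta>) \<Longrightarrow>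
      fock_integral q (fock_op i m \<psi> f) \<le> ennreal (K * \<epsilon> powr q) * fock_integral q f + ennreal (A * \<delta> powr q)"
      using bnd[OF R] by blast
    define \<delta> where "\<delta> = (e / (2 * (A + 1))) powr (1/q)"
    have \<delta>: "0 < \<delta>" using e A by (simp add: \<delta>_def)
    have \<delta>A: "A * \<delta> powr q \<le> e/2"
    proof -
      have "\<delta> powr q = e / (2 * (A + 1))" using q e A by (simp add: \<delta>_def powr_powr)
      then have "A * \<delta> powr q = e/2 * (A / (A + 1))" by simp
      also have "\<dots> \<le> e/2 * 1" using e A by (intro mult_left_mono) auto
      finally show ?thesis by simp
    qed
    \<comment> \<open>The disc of radius \<open>S\<close> contains the image of the disc of radius
      \<open>R\<close> with a margin of 1, on which Cauchy's estimate for the derivative is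
      used.\<close>
    define S where "S = cmod a * R + cmod b + 1"
    have "uniform_limit (cball 0 S) (fs \<circ> r) f sequentially" by (rule ulim) simp
    then have "eventually (\<lambda>n. \<forall>u\<in>cball 0 S. dist ((fs \<circ> r) n u) (f u) < \<delta>) sequentially"
      using \<delta> unfolding uniform_limit_iff by blast
    then show "eventually (\<lambda>n. fock_integral q (fock_op i m \<psi> (h n)) \<le> ennreal e) sequentially"
    proof eventually_elim
      case (elim n)
      have hu: "cmod (h n u) \<le> \<delta>" if "cmod u \<le> S" for u
        using elim that by (auto simp: h_def dist_norm intro: less_imp_le)
      have near: "\<forall>z. cmod z \<le> R \<longrightarrow> cmod ((deriv ^^ i) (h n) (\<psi> z)) \<le> \<delta>"
      proof (intro allI impI)
        fix z assume z: "cmod z \<le> R"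
        have "cmod (\<psi> z) \<le> cmod a * cmod z + cmod b"
          unfolding \<psi> by (metis norm_triangle_ineq norm_mult)
        also have "\<dots> \<le> cmod a * R + cmod b" using z by (intro add_mono mult_left_mono) auto
        finally have \<psi>S: "cmod (\<psi> z) \<le> S - 1" by (simp add: S_def)
        show "cmod ((deriv ^^ i) (h n) (\<psi> z)) \<le> \<delta>"
        proof (cases "i = 0")
          case True
          then show ?thesis using hu[of "\<psi> z"] \<psi>S by simp
        next
          case False
          then have "i = 1" using i by simp
          moreover have "cmod (deriv (h n) (\<psi> z)) \<le> \<delta> / 1"
          proof (rule entire_deriv_bound[OF hh])
            fix x assume "cmod (\<psi> z - x) = 1"
            then have "cmod x \<le> S"
              using \<psi>S norm_triangle_sub[of x "\<psi> z"] by (simp add: norm_minus_commute)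
            then show "cmod (h n x) \<le> \<delta>" by (rule hu)
          qed simp
          ultimately show ?thesis by simp
        qed
      qed
      have "fock_integral q (fock_op i m \<psi> (h n)) \<le> ennreal (K * \<epsilon> powr q) * fock_integral q (h n) + ennreal (A * \<delta> powr q)"
        using \<epsilon> \<delta> by (intro bnd' hh far near) auto
      also have "\<dots> \<le> ennreal (K * \<epsilon> powr q) * ennreal E + ennreal (A * \<delta> powr q)"
        by (intro add_right_mono mult_left_mono hE) auto
      also have "\<dots> = ennreal (K * \<epsilon> powr q * E + A * \<delta> powr q)"
        using K E A by (simp add: ennreal_mult)
      also have "\<dots> \<le> ennreal e"
        using \<epsilon>E \<delta>A by (intro ennreal_leI) argo
      finally show ?case .
    qed
  qed
  then have "(\<lambda>n. fock_norm q (fock_op i m \<psi> (h n))) \<longlonglongrightarrow> 0"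
    using fock_norm_tendsto_zero_iff[OF q, of "\<lambda>n. fock_op i m \<psi> (h n)"]
      fock_in_fock_op[OF p pq i a \<psi> m lim hin] by blast
  moreover have "fock_op i m \<psi> (h n) = (\<lambda>z. fock_op i m \<psi> (fs (r n)) z - fock_op i m \<psi> f z)" for n
    unfolding h_def using fock_op_diff[OF m \<psi>h fsh fh] by (intro ext)
  moreover have "fock_in q (fock_op i m \<psi> f)" by (rule fock_in_fock_op[OF p pq i a \<psi> m lim fin])
  ultimately show "\<exists>r h. strict_mono r \<and> fock_in q h \<and> (\<lambda>n. fock_norm q (\<lambda>z. fock_op i m \<psi> (fs (r n)) z - h z)) \<longlonglongrightarrow> 0"
    using r by (intro exI[of _ r] exI[of _ "fock_op i m \<psi> f"]) simp
qed

section \<open>From compactness to decay of the symbol\<close>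

lemma fock_compact_opE:
  fixes fs :: "nat \<Rightarrow> complex \<Rightarrow> complex"
  assumes "fock_compact_op p q T" "\<And>n. fock_in p (fs n)" "\<And>n. fock_norm p (fs n) \<le> B"
  obtains r h where "strict_mono r" "fock_in q h"
    "(\<lambda>n. fock_norm q (\<lambda>z. T (fs (r n)) z - h z)) \<longlonglongrightarrow> 0"
proof -
  have "(\<forall>n. fock_in p (fs n)) \<and> (\<exists>B. \<forall>n. fock_norm p (fs n) \<le> B)"
    using assms(2,3) by blast
  from assms(1)[unfolded fock_compact_op_def, rule_format, OF this] show ?thesis
    using that by blast
qed

text \<open>Convergence in norm implies pointwise convergence of values and derivatives. Hence the
  limit \<open>h\<close> has derivative 0 and vanishes at 0, so it is 0.\<close>

lemma fock_compact_op_subseq_zero: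
  assumes q: "0 < q" and T: "fock_compact_op p q T"
    and fs: "\<And>n. fock_in p (fs n)" "\<And>n. fock_norm p (fs n) \<le> B"
    and Tfs: "\<And>n. fock_in q (T (fs n))" "\<And>n. T (fs n) 0 = 0" "\<And>z. (\<lambda>n. deriv (T (fs n)) z) \<longlonglongrightarrow> 0"
  shows "\<exists>r. strict_mono r \<and> (\<lambda>n. fock_norm q (T (fs (r n)))) \<longlonglongrightarrow> 0"
proof -
  obtain r h where r: "strict_mono r" and h: "fock_in q h"
    and lim: "(\<lambda>n. fock_norm q (\<lambda>z. T (fs (r n)) z - h z)) \<longlonglongrightarrow> 0"
    by (rule fock_compact_opE[OF T fs])
  obtain C where pt: "\<And>f z i. fock_in q f \<Longrightarrow> i \<le> 1 \<Longrightarrow>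
     cmod ((deriv ^^ i) f z) \<le> C * (1 + cmod z) ^ i * exp ((cmod z)\<^sup>2 / 2) * fock_norm q f"
    using fock_pointwise[OF q] by metis
  have hh: "h holomorphic_on UNIV" and Th: "T (fs n) holomorphic_on UNIV" for n
    using h Tfs by (auto simp: fock_in_def)
  have conv: "(\<lambda>n. (deriv ^^ i) (T (fs (r n))) z - (deriv ^^ i) h z) \<longlonglongrightarrow> 0" if "i \<le> 1" for i z
  proof (rule Lim_null_comparison)
    show "eventually (\<lambda>n. norm ((deriv ^^ i) (T (fs (r n))) z - (deriv ^^ i) h z) \<le>
       C * (1 + cmod z) ^ i * exp ((cmod z)\<^sup>2 / 2) * fock_norm q (\<lambda>z. T (fs (r n)) z - h z)) sequentially"
      using pt[OF fock_in_diff[OF q Tfs(1) h] that] deriv_funpow_diff[OF Th hh] by simp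
    show "(\<lambda>n. C * (1 + cmod z) ^ i * exp ((cmod z)\<^sup>2 / 2) * fock_norm q (\<lambda>z. T (fs (r n)) z - h z)) \<longlonglongrightarrow> 0"
      using tendsto_mult_left[OF lim] by simp
  qed
  have dh: "deriv h z = 0" for z
  proof -
    have "(\<lambda>n. deriv (T (fs (r n))) z) \<longlonglongrightarrow> 0"
      using LIMSEQ_subseq_LIMSEQ[OF Tfs(3) r] by (simp add: o_def)
    from tendsto_diff[OF this conv[of 1 z]] have "(\<lambda>n::nat. deriv h z) \<longlonglongrightarrow> 0" by simp
    then show ?thesis by (simp add: LIMSEQ_const_iff)
  qed
  have h0: "h 0 = 0" using conv[of 0 0] by (simp add: Tfs(2) LIMSEQ_const_iff)
  have "\<exists>c. \<forall>z\<in>UNIV. h z = c"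
  proof (rule has_field_derivative_zero_constant)
    fix z show "(h has_field_derivative 0) (at z within UNIV)"
      using holomorphic_derivI[OF hh, of z] dh by simp
  qed auto
  then have "h z = 0" for z using h0 by (metis UNIV_I)
  then show ?thesis using lim r by auto
qed

text \<open>If the symbol stays above \<open>\<epsilon>\<close> along points tending to infinity,
  the test functions at their images are bounded and tend to 0 pointwise, so their images under
  \<open>T\<close> tend to 0 in norm along a subsequence. The derivative estimate at these points
  bounds the symbol by that norm. Keeping a second branch \<open>\<theta>\<close>, \<open>n\<close>
  abstract covers equal inner maps and both orders of distinct ones.\<close>

lemma fock_symbol_tendsto_zero_if_compact:
  fixes \<psi> \<theta> m n :: "complex \<Rightarrow> complex"
  assumes p: "0 < p" and q: "0 < q" and i: "i \<le> 1" and a: "a \<noteq> 0" and \<psi>: "\<psi> = (\<lambda>z. a * z + b)"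
    and T: "fock_compact_op p q T"
    and Tin: "\<And>f. fock_in p f \<Longrightarrow> fock_in q (T f)" and T0: "\<And>f. fock_in p f \<Longrightarrow> T f 0 = 0"
    and dT: "\<And>f z. fock_in p f \<Longrightarrow> deriv (T f) z = (deriv ^^ i) f (\<psi> z) * m z - (deriv ^^ i) f (\<theta> z) * n z"
    and B: "0 \<le> B"
    and test: "\<And>z. R \<le> cmod z \<Longrightarrow> \<exists>\<alpha> \<beta>. cmod \<alpha> \<le> B \<and> cmod \<beta> \<le> B \<and>
        cmod ((deriv ^^ i) (fock_test \<alpha> \<beta> (\<psi> z)) (\<psi> z)) = cmod (\<psi> z) ^ i * exp ((cmod (\<psi> z))\<^sup>2 / 2) \<and>
        (deriv ^^ i) (fock_test \<alpha> \<beta> (\<psi> z)) (\<theta> z) * n z = 0"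
  shows "(fock_symbol i m \<psi> \<longlongrightarrow> 0) at_infinity"
proof (rule ccontr)
  assume "\<not> ?thesis"
  then obtain \<epsilon> where \<epsilon>: "0 < \<epsilon>" and bad: "\<And>x. \<exists>z. x \<le> cmod z \<and> \<epsilon> \<le> fock_symbol i m \<psi> z"
    unfolding Lim_at_infinity by (auto simp: not_less dist_norm)
  \<comment> \<open>Beyond \<open>R'\<close> test functions exist and \<open>cmod (\<psi> z)\<close>
    is at least 1.\<close>
  define R' where "R' = max R ((1 + cmod b) / cmod a)"
  obtain z where z: "\<And>k::nat. R' + real k \<le> cmod (z k)" and zsym: "\<And>k. \<epsilon> \<le> fock_symbol i m \<psi> (z k)"
    using bad[of "R' + real k" for k] by metis
  have zR: "R \<le> cmod (z k)" for k using z[of k] by (simp add: R'_def)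
  have \<psi>low: "1 + cmod a * real k \<le> cmod (\<psi> (z k))" for k
  proof -
    have "(1 + cmod b) / cmod a + real k \<le> cmod (z k)" using z[of k] by (simp add: R'_def)
    then have "cmod a * ((1 + cmod b) / cmod a + real k) \<le> cmod a * cmod (z k)" by (intro mult_left_mono) auto
    moreover have "cmod a * ((1 + cmod b) / cmod a) = 1 + cmod b" using a by simp
    ultimately have "1 + cmod b + cmod a * real k \<le> cmod (a * z k)"
      unfolding distrib_left[of "cmod a" "(1 + cmod b) / cmod a"] norm_mult by metis
    moreover have "cmod (a * z k) \<le> cmod (\<psi> (z k)) + cmod b"
      unfolding \<psi> using norm_triangle_ineq4[of "a * z k + b" b] by simp
    ultimately show ?thesis by argo
  qed
  have \<psi>1: "1 \<le> cmod (\<psi> (z k))" for k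
    using \<psi>low[of k] mult_nonneg_nonneg[OF norm_ge_zero[of a] of_nat_0_le_iff[of k]] by argo
  have \<psi>inf: "filterlim (\<lambda>k. cmod (\<psi> (z k))) at_top sequentially"
  proof (rule filterlim_at_top_mono)
    have "0 < cmod a" using a by simp
    then show "filterlim (\<lambda>k. 1 + cmod a * real k) at_top sequentially" by real_asymp
    show "eventually (\<lambda>k. 1 + cmod a * real k \<le> cmod (\<psi> (z k))) sequentially" using \<psi>low by simp
  qed
  obtain \<alpha> \<beta> where ab: "\<And>k. cmod (\<alpha> k) \<le> B" "\<And>k. cmod (\<beta> k) \<le> B"
    and t1: "\<And>k. cmod ((deriv ^^ i) (fock_test (\<alpha> k) (\<beta> k) (\<psi> (z k))) (\<psi> (z k))) = cmod (\<psi> (z k)) ^ i * exp ((cmod (\<psi> (z k)))\<^sup>2 / 2)"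
    and t2: "\<And>k. (deriv ^^ i) (fock_test (\<alpha> k) (\<beta> k) (\<psi> (z k))) (\<theta> (z k)) * n (z k) = 0"
    using test[OF zR] by metis
  define fs where "fs = (\<lambda>k. fock_test (\<alpha> k) (\<beta> k) (\<psi> (z k)))"
  obtain K where fs: "\<And>k. fock_in p (fs k)" "\<And>k. fock_norm p (fs k) \<le> K"
    using fock_test_bounded[OF p B] ab unfolding fs_def by metis
  have Dfs: "(\<lambda>k. (deriv ^^ i) (fs k) x) \<longlonglongrightarrow> 0" for x
    unfolding fs_def by (rule fock_test_tendsto_zero[OF \<psi>inf ab i])
  have "(\<lambda>k. deriv (T (fs k)) x) \<longlonglongrightarrow> 0" for x
  proof -
    have "(\<lambda>k. (deriv ^^ i) (fs k) (\<psi> x) * m x - (deriv ^^ i) (fs k) (\<theta> x) * n x) \<longlonglongrightarrow> 0 * m x - 0 * n x"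
      by (intro tendsto_diff tendsto_mult tendsto_const Dfs)
    then show ?thesis by (simp add: dT[OF fs(1)])
  qed
  then obtain r where r: "strict_mono r" and lim: "(\<lambda>k. fock_norm q (T (fs (r k)))) \<longlonglongrightarrow> 0"
    using fock_compact_op_subseq_zero[of q p T fs K, OF q T fs Tin[OF fs(1)] T0[OF fs(1)]] by blast
  obtain C where C: "0 < C" and pt: "\<And>f z i. fock_in q f \<Longrightarrow> i \<le> 1 \<Longrightarrow>
     cmod ((deriv ^^ i) f z) \<le> C * (1 + cmod z) ^ i * exp ((cmod z)\<^sup>2 / 2) * fock_norm q f"
    using fock_pointwise[OF q] by metis
  have "fock_symbol i m \<psi> (z k) \<le> 2 * C * fock_norm q (T (fs k))" for k
  proof -
    define x y where "x = cmod (z k)" and "y = cmod (\<psi> (z k))"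
    have y1: "1 \<le> y" using \<psi>1 by (simp add: y_def)
    have x0: "0 < 1 + x" by (simp add: x_def add_pos_nonneg)
    have "deriv (T (fs k)) (z k) = (deriv ^^ i) (fs k) (\<psi> (z k)) * m (z k)"
      unfolding dT[OF fs(1)] using t2[of k] by (simp add: fs_def)
    then have "y ^ i * exp (y\<^sup>2 / 2) * cmod (m (z k)) = cmod (deriv (T (fs k)) (z k))"
      using t1[of k] by (simp add: norm_mult fs_def y_def)
    also have "\<dots> \<le> C * (1 + x) * exp (x\<^sup>2 / 2) * fock_norm q (T (fs k))"
      using pt[OF Tin[OF fs(1)], of 1 k "z k"] by (simp add: x_def)
    finally have le: "y ^ i * exp (y\<^sup>2 / 2) * cmod (m (z k)) \<le> C * (1 + x) * exp (x\<^sup>2 / 2) * fock_norm q (T (fs k))" .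
    \<comment> \<open>The test functions produce \<open>y ^ i\<close>, the symbol contains
      \<open>(1 + y) ^ i\<close>. For \<open>y \<ge> 1\<close> this costs the factor 2.\<close>
    have "(1 + y) ^ i \<le> 2 * y ^ i" using i y1 by (cases "i = 0") (auto simp: le_Suc_eq)
    then have "(cmod (m (z k)) * exp (y\<^sup>2 / 2)) * (1 + y) ^ i \<le> (cmod (m (z k)) * exp (y\<^sup>2 / 2)) * (2 * y ^ i)"
      by (intro mult_left_mono) auto
    also have "\<dots> = 2 * (y ^ i * exp (y\<^sup>2 / 2) * cmod (m (z k)))" by simp
    also have "\<dots> \<le> 2 * (C * (1 + x) * exp (x\<^sup>2 / 2) * fock_norm q (T (fs k)))"
      using le by (intro mult_left_mono) auto
    also have "\<dots> = (2 * C * fock_norm q (T (fs k))) * ((1 + x) * exp (x\<^sup>2 / 2))" by simp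
    finally have "cmod (m (z k)) * exp (y\<^sup>2 / 2) * (1 + y) ^ i / ((1 + x) * exp (x\<^sup>2 / 2)) \<le> 2 * C * fock_norm q (T (fs k))"
      using x0 by (subst pos_divide_le_eq) auto
    moreover have "fock_symbol i m \<psi> (z k) = cmod (m (z k)) * exp (y\<^sup>2 / 2) * (1 + y) ^ i / ((1 + x) * exp (x\<^sup>2 / 2))"
      unfolding fock_symbol_def x_def[symmetric] y_def[symmetric] diff_divide_distrib exp_diff by simp
    ultimately show ?thesis by simp
  qed
  then have "\<epsilon> \<le> 2 * C * fock_norm q (T (fs (r k)))" for k
    using zsym order_trans by blast
  moreover have "(\<lambda>k. 2 * C * fock_norm q (T (fs (r k)))) \<longlonglongrightarrow> 2 * C * 0"
    by (intro tendsto_intros lim)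
  ultimately have "\<epsilon> \<le> 2 * C * 0"
    by (intro LIMSEQ_le_const) auto
  then show False using \<epsilon> by simp
qed

text \<open>With \<open>\<beta> = 1 / (w - u)\<close> the factor
  \<open>1 + \<beta> * (z - w)\<close> is 1 at \<open>w\<close> and 0 at \<open>u\<close>. For
  \<open>i = 1\<close> the correction \<open>\<beta> / cnj w\<close> in \<open>\<alpha>\<close>
  makes the polynomial factor of the derivative equal to \<open>cnj w\<close> at \<open>w\<close>
  and 0 at \<open>u\<close>. The distance \<open>\<delta>\<close> and \<open>cmod w \<ge> 1\<close>
  bound the coefficients.\<close>

lemma fock_test_vanishing:
  assumes w: "1 \<le> cmod w" and \<delta>: "0 < \<delta>" "\<delta> \<le> cmod (w - u)" and i: "i \<le> 1"
  shows "\<exists>\<alpha> \<beta>. cmod \<alpha> \<le> 1 + 1/\<delta> \<and> cmod \<beta> \<le> 1 + 1/\<delta> \<and>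
        cmod ((deriv ^^ i) (fock_test \<alpha> \<beta> w) w) = cmod w ^ i * exp ((cmod w)\<^sup>2 / 2) \<and>
        (deriv ^^ i) (fock_test \<alpha> \<beta> w) u = 0"
proof -
  define \<beta> where "\<beta> = 1 / (w - u)"
  have wu: "w - u \<noteq> 0" using \<delta> by auto
  have w0: "cnj w \<noteq> 0" using w by auto
  have \<beta>: "cmod \<beta> \<le> 1/\<delta>" using \<delta> by (simp add: \<beta>_def norm_divide frac_le)
  have \<beta>u: "\<beta> * (u - w) = -1" using wu by (simp add: \<beta>_def field_simps)
  have k: "cmod (exp (cnj w * w - of_real ((cmod w)\<^sup>2 / 2))) = exp ((cmod w)\<^sup>2 / 2)"
    using cmod_fock_kernel[of w w] by simp
  show ?thesis
  proof (cases "i = 0")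
    case True
    then show ?thesis using \<beta> \<beta>u \<delta> k
      by (intro exI[of _ 1] exI[of _ \<beta>]) (auto simp: fock_test_def)
  next
    case False
    then have i: "i = 1" using i by simp
    define \<alpha> where "\<alpha> = 1 - \<beta> / cnj w"
    have "cmod (\<beta> / cnj w) \<le> (1/\<delta>) / 1"
      unfolding norm_divide using \<beta> w \<delta> by (intro frac_le) auto
    then have "cmod \<alpha> \<le> 1 + 1/\<delta>"
      unfolding \<alpha>_def using norm_triangle_ineq4[of 1 "\<beta> / cnj w"] by simp
    moreover have "\<beta> + cnj w * \<alpha> = cnj w" using w0 by (simp add: \<alpha>_def field_simps)
    moreover have "\<beta> + cnj w * (\<alpha> + \<beta> * (u - w)) = 0"
      using w0 unfolding \<beta>u by (simp add: \<alpha>_def field_simps)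
    ultimately show ?thesis using \<beta> \<delta> k i
      by (intro exI[of _ \<alpha>] exI[of _ \<beta>]) (auto simp: deriv_fock_test norm_mult)
  qed
qed

lemma fock_compact_op_cong:
  assumes "\<And>f. fock_in p f \<Longrightarrow> T f = S f"
  shows "fock_compact_op p q T \<longleftrightarrow> fock_compact_op p q S"
  unfolding fock_compact_op_def using assms by simp

text \<open>The second subsequence is extracted along the first, and the two errors are combined at
  the level of integrals.\<close>

lemma fock_compact_op_diff:
  assumes q: "0 < q" and S: "fock_compact_op p q S" and T: "fock_compact_op p q T"
    and Sin: "\<And>f. fock_in p f \<Longrightarrow> fock_in q (S f)" and Tin: "\<And>f. fock_in p f \<Longrightarrow> fock_in q (T f)"
  shows "fock_compact_op p q (\<lambda>f z. S f z - T f z)"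
  unfolding fock_compact_op_def
proof (intro allI impI)
  fix fs :: "nat \<Rightarrow> complex \<Rightarrow> complex"
  assume "(\<forall>n. fock_in p (fs n)) \<and> (\<exists>B. \<forall>n. fock_norm p (fs n) \<le> B)"
  then obtain B where fs: "\<And>n. fock_in p (fs n)" "\<And>n. fock_norm p (fs n) \<le> B" by auto
  obtain r h where r: "strict_mono r" and h: "fock_in q h"
    and lim: "(\<lambda>n. fock_norm q (\<lambda>z. S (fs (r n)) z - h z)) \<longlonglongrightarrow> 0"
    by (rule fock_compact_opE[OF S fs])
  obtain r' k where r': "strict_mono r'" and k: "fock_in q k"
    and lim': "(\<lambda>n. fock_norm q (\<lambda>z. T (fs (r (r' n))) z - k z)) \<longlonglongrightarrow> 0"
    by (rule fock_compact_opE[OF T, of "\<lambda>n. fs (r n)" B]) (use fs in auto)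
  define u v where "u = (\<lambda>n z. S (fs (r (r' n))) z - h z)" and "v = (\<lambda>n z. T (fs (r (r' n))) z - k z)"
  have u: "fock_in q (u n)" and v: "fock_in q (v n)" for n
    unfolding u_def v_def by (intro fock_in_diff q Sin Tin fs h k)+
  have "(\<lambda>n. fock_norm q (u n)) \<longlonglongrightarrow> 0"
    unfolding u_def using LIMSEQ_subseq_LIMSEQ[OF lim r'] by (simp add: o_def)
  then have "(\<lambda>n. fock_integral q (u n)) \<longlonglongrightarrow> 0"
    using fock_norm_tendsto_zero_iff[OF q u] by simp
  moreover have "(\<lambda>n. fock_integral q (v n)) \<longlonglongrightarrow> 0"
    using lim' fock_norm_tendsto_zero_iff[OF q v] by (simp add: v_def)
  ultimately have "(\<lambda>n. ennreal (2 powr q) * (fock_integral q (u n) + fock_integral q (v n))) \<longlonglongrightarrow> ennreal (2 powr q) * (0 + 0)"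
    by (intro ennreal_tendsto_cmult tendsto_add) auto
  then have lim0: "(\<lambda>n. ennreal (2 powr q) * (fock_integral q (u n) + fock_integral q (v n))) \<longlonglongrightarrow> 0" by simp
  have le: "fock_integral q (\<lambda>z. u n z - v n z) \<le> ennreal (2 powr q) * (fock_integral q (u n) + fock_integral q (v n))" for n
    using u v by (intro fock_integral_diff_le q) (auto simp: fock_in_def)
  have "(\<lambda>n. fock_integral q (\<lambda>z. u n z - v n z)) \<longlonglongrightarrow> 0"
    by (rule tendsto_sandwich[OF _ _ tendsto_const lim0]) (use le in auto)
  then have "(\<lambda>n. fock_norm q (\<lambda>z. u n z - v n z)) \<longlonglongrightarrow> 0"
    using fock_norm_tendsto_zero_iff[OF q fock_in_diff[OF q u v]] by simp
  moreover have "(\<lambda>z. u n z - v n z) = (\<lambda>z. (S (fs (r (r' n))) z - T (fs (r (r' n))) z) - (h z - k z))" for n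
    by (auto simp: u_def v_def)
  moreover have "strict_mono (r \<circ> r')" using r r' by (rule strict_mono_o)
  moreover have "fock_in q (\<lambda>z. h z - k z)" by (rule fock_in_diff[OF q h k])
  ultimately show "\<exists>r h. strict_mono r \<and> fock_in q h \<and> (\<lambda>n. fock_norm q (\<lambda>z. S (fs (r n)) z - T (fs (r n)) z - h z)) \<longlonglongrightarrow> 0"
    by (intro exI[of _ "r \<circ> r'"] exI[of _ "\<lambda>z. h z - k z"]) simp
qed

section \<open>Boundedness forces affine inner maps\<close>

text \<open>The operator is tested at each \<open>z\<close> on the kernel at
  \<open>\<psi> z\<close>, whose modulus there is the exponential on the left. The derivative
  estimate for the image does the rest.\<close>

lemma fock_op_0_growth:
  assumes p: "0 < p" and q: "0 < q" and m: "m holomorphic_on UNIV" and \<psi>: "\<psi> holomorphic_on UNIV"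
    and bdd: "fock_bounded_op p q (fock_op 0 m \<psi>)"
  shows "\<exists>C\<ge>0. \<forall>z. cmod (m z) * exp ((cmod (\<psi> z))\<^sup>2 / 2) \<le> C * (1 + cmod z) * exp ((cmod z)\<^sup>2 / 2)"
proof -
  obtain D where D: "\<And>f. fock_in p f \<Longrightarrow> fock_in q (fock_op 0 m \<psi> f) \<and> fock_norm q (fock_op 0 m \<psi> f) \<le> D * fock_norm p f"
    using bdd unfolding fock_bounded_op_def by blast
  obtain C where C: "0 < C" and pt: "\<And>f z i. fock_in q f \<Longrightarrow> i \<le> 1 \<Longrightarrow>
     cmod ((deriv ^^ i) f z) \<le> C * (1 + cmod z) ^ i * exp ((cmod z)\<^sup>2 / 2) * fock_norm q f"
    using fock_pointwise[OF q] by metis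
  obtain K where K: "\<And>w. fock_in p (fock_test 1 0 w) \<and> fock_norm p (fock_test 1 0 w) \<le> K"
    using fock_test_bounded[OF p, of 1] by (metis norm_one norm_zero order_refl zero_le_one)
  have "cmod (m z) * exp ((cmod (\<psi> z))\<^sup>2 / 2) \<le> (C * (\<bar>D\<bar> * K)) * (1 + cmod z) * exp ((cmod z)\<^sup>2 / 2)" for z
  proof -
    define f where "f = fock_test 1 0 (\<psi> z)"
    have f: "fock_in p f" "fock_norm p f \<le> K" using K by (auto simp: f_def)
    have fh: "f holomorphic_on UNIV" by (simp add: f_def fock_test_holomorphic)
    have "cmod (f (\<psi> z)) = exp ((cmod (\<psi> z))\<^sup>2 / 2)"
      using cmod_fock_kernel[of "\<psi> z" "\<psi> z"] by (simp add: f_def fock_test_def)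
    then have "cmod (m z) * exp ((cmod (\<psi> z))\<^sup>2 / 2) = cmod (deriv (fock_op 0 m \<psi> f) z)"
      by (simp add: deriv_fock_op[OF m \<psi> fh] norm_mult)
    also have "\<dots> \<le> C * (1 + cmod z) * exp ((cmod z)\<^sup>2 / 2) * fock_norm q (fock_op 0 m \<psi> f)"
      using pt[of "fock_op 0 m \<psi> f" 1 z] D[OF f(1)] by simp
    also have "\<dots> \<le> C * (1 + cmod z) * exp ((cmod z)\<^sup>2 / 2) * (\<bar>D\<bar> * K)"
    proof (intro mult_left_mono)
      have "fock_norm q (fock_op 0 m \<psi> f) \<le> D * fock_norm p f" using D[OF f(1)] by blast
      \<comment> \<open>The constant in \<open>fock_bounded_op\<close> carries no sign condition,
        hence the absolute value.\<close>
      also have "\<dots> \<le> \<bar>D\<bar> * K" using f(2) by (intro mult_mono) auto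
      finally show "fock_norm q (fock_op 0 m \<psi> f) \<le> \<bar>D\<bar> * K" .
    qed (use C in auto)
    finally show ?thesis by (simp add: mult_ac)
  qed
  moreover have "0 \<le> K" using K[of 0] fock_norm_nonneg order_trans by blast
  ultimately show ?thesis using C by (intro exI[of _ "C * (\<bar>D\<bar> * K)"]) auto
qed

text \<open>A nonconstant \<open>g\<close> supplies a point where the weight \<open>deriv g\<close>
  is nonzero, and a nonconstant \<open>\<psi>\<close> gives \<open>a \<noteq> 0\<close>.\<close>

lemma Vop_bounded_imp_affine:
  assumes p: "0 < p" and q: "0 < q" and g: "g holomorphic_on UNIV" and \<psi>: "\<psi> holomorphic_on UNIV"
    and gn: "nonconstant g" and \<psi>n: "nonconstant \<psi>" and bdd: "fock_bounded_op p q (Vop g \<psi>)"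
  obtains a b where "a \<noteq> 0" "\<psi> = (\<lambda>z. a * z + b)"
proof -
  have dg: "deriv g holomorphic_on UNIV" using g by (simp add: holomorphic_deriv)
  have "\<exists>z0. deriv g z0 \<noteq> 0"
  proof (rule ccontr)
    assume "\<not> ?thesis"
    then have "\<exists>c. \<forall>z\<in>UNIV. g z = c"
      using holomorphic_derivI[OF g open_UNIV UNIV_I]
      by (intro has_field_derivative_zero_constant) auto
    then show False using gn by (auto simp: nonconstant_def)
  qed
  then obtain z0 where z0: "deriv g z0 \<noteq> 0" by blast
  obtain C where "0 \<le> C" "\<And>z. cmod (deriv g z) * exp ((cmod (\<psi> z))\<^sup>2 / 2) \<le> C * (1 + cmod z) * exp ((cmod z)\<^sup>2 / 2)"
    using fock_op_0_growth[OF p q dg \<psi>] bdd by (auto simp: Vop_eq_fock_op)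
  then obtain a b where ab: "\<psi> = (\<lambda>z. a * z + b)"
    using affine_if_exp_growth[OF \<psi> dg z0] by blast
  moreover have "a \<noteq> 0" using \<psi>n ab by (auto simp: nonconstant_def)
  ultimately show ?thesis using that by blast
qed

section \<open>Compactness of differences\<close>

text \<open>The difference of two distinct affine maps is either a nonzero constant or has modulus
  tending to infinity. This supplies the \<open>\<delta>\<close> of
  \<open>fock_test_vanishing\<close>.\<close>

lemma affine_separated:
  fixes a b c d :: complex
  assumes ne: "(\<lambda>z. a * z + b) \<noteq> (\<lambda>z. c * z + d)"
  shows "\<exists>\<delta>>0. \<exists>R. \<forall>z. R \<le> cmod z \<longrightarrow> \<delta> \<le> cmod ((a * z + b) - (c * z + d))"
proof (cases "a = c")
  case True
  then have "b \<noteq> d" using ne by auto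
  then show ?thesis using True by (intro exI[of _ "cmod (b - d)"]) auto
next
  case False
  define k where "k = cmod (a - c)"
  have k: "0 < k" using False by (simp add: k_def)
  have "1 \<le> cmod ((a * z + b) - (c * z + d))" if "(1 + cmod (b - d)) / k \<le> cmod z" for z
  proof -
    have "1 + cmod (b - d) \<le> cmod ((a - c) * z)"
      using that k by (simp add: pos_divide_le_eq norm_mult k_def mult.commute)
    also have "(a - c) * z = ((a * z + b) - (c * z + d)) - (b - d)" by (simp add: algebra_simps)
    also have "cmod \<dots> \<le> cmod ((a * z + b) - (c * z + d)) + cmod (b - d)" by (rule norm_triangle_ineq4)
    finally show ?thesis by simp
  qed
  then show ?thesis by (intro exI[of _ 1]) auto
qed

lemma affine_large:
  fixes a b :: complex
  assumes "a \<noteq> 0"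
  shows "\<exists>R. \<forall>z. R \<le> cmod z \<longrightarrow> 1 \<le> cmod (a * z + b)"
proof -
  have "1 \<le> cmod (a * z + b)" if "(1 + cmod b) / cmod a \<le> cmod z" for z
  proof -
    have "1 + cmod b \<le> cmod (a * z)"
      using that assms by (simp add: pos_divide_le_eq norm_mult mult.commute)
    also have "a * z = (a * z + b) - b" by simp
    also have "cmod \<dots> \<le> cmod (a * z + b) + cmod b" by (rule norm_triangle_ineq4)
    finally show ?thesis by simp
  qed
  then show ?thesis by blast
qed

text \<open>For equal inner maps the difference is the operator with weight \<open>m - n\<close>,
  and plain kernels show that its symbol decays. For distinct ones the vanishing test functions
  isolate each operator in turn, so both symbols decay and both operators are compact.\<close>

lemma fock_op_diff_compact_iff:
  assumes p: "0 < p" and pq: "p \<le> q" and i: "i \<le> 1"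
    and m: "m holomorphic_on UNIV" and n: "n holomorphic_on UNIV"
    and a: "a \<noteq> 0" and \<psi>: "\<psi> = (\<lambda>z. a * z + b)" and c: "c \<noteq> 0" and \<theta>: "\<theta> = (\<lambda>z. c * z + d)"
    and bm: "fock_bounded_op p q (fock_op i m \<psi>)" and bn: "fock_bounded_op p q (fock_op i n \<theta>)"
  shows "fock_compact_op p q (\<lambda>f z. fock_op i m \<psi> f z - fock_op i n \<theta> f z) \<longleftrightarrow>
     (fock_compact_op p q (fock_op i m \<psi>) \<and> fock_compact_op p q (fock_op i n \<theta>)) \<or>
     (\<psi> = \<theta> \<and> (fock_symbol i (\<lambda>z. m z - n z) \<psi> \<longlongrightarrow> 0) at_infinity)"
proof -
  have q: "0 < q" using p pq by simp
  have \<psi>h: "\<psi> holomorphic_on UNIV" unfolding \<psi> by (intro holomorphic_intros)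
  have \<theta>h: "\<theta> holomorphic_on UNIV" unfolding \<theta> by (intro holomorphic_intros)
  have mn: "(\<lambda>z. m z - n z) holomorphic_on UNIV" by (intro holomorphic_intros m n)
  have fh: "f holomorphic_on UNIV" if "fock_in p f" for f using that by (simp add: fock_in_def)
  have min: "fock_in q (fock_op i m \<psi> f)" and nin: "fock_in q (fock_op i n \<theta> f)" if "fock_in p f" for f
    using bm bn that unfolding fock_bounded_op_def by blast+
  define T where "T = (\<lambda>f z. fock_op i m \<psi> f z - fock_op i n \<theta> f z)"
  have Tin: "fock_in q (T f)" if "fock_in p f" for f
    unfolding T_def by (intro fock_in_diff q min nin that)
  have T0: "T f 0 = 0" if "fock_in p f" for f
    using fock_op_0[OF m \<psi>h fh[OF that]] fock_op_0[OF n \<theta>h fh[OF that]] by (simp add: T_def)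
  have dT: "deriv (T f) z = (deriv ^^ i) f (\<psi> z) * m z - (deriv ^^ i) f (\<theta> z) * n z" if "fock_in p f" for f z
  proof -
    note f = fh[OF that]
    have "fock_op i m \<psi> f holomorphic_on UNIV" "fock_op i n \<theta> f holomorphic_on UNIV"
      by (intro holomorphic_fock_op m n \<psi>h \<theta>h f)+
    from deriv_funpow_diff[OF this, of 1 z] show ?thesis
      by (simp add: T_def deriv_fock_op[OF m \<psi>h f] deriv_fock_op[OF n \<theta>h f])
  qed
  show ?thesis
  proof
    assume "fock_compact_op p q (\<lambda>f z. fock_op i m \<psi> f z - fock_op i n \<theta> f z)"
    then have TC: "fock_compact_op p q T" by (simp add: T_def)
    show "(fock_compact_op p q (fock_op i m \<psi>) \<and> fock_compact_op p q (fock_op i n \<theta>)) \<or>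
     (\<psi> = \<theta> \<and> (fock_symbol i (\<lambda>z. m z - n z) \<psi> \<longlongrightarrow> 0) at_infinity)"
    proof (cases "\<psi> = \<theta>")
      case True
      have "(fock_symbol i (\<lambda>z. m z - n z) \<psi> \<longlongrightarrow> 0) at_infinity"
      proof (rule fock_symbol_tendsto_zero_if_compact[OF p q i a \<psi> TC Tin T0])
        \<comment> \<open>The second branch gets weight 0, so the vanishing requirement is trivial
          and the kernel with \<open>\<alpha> = 1\<close>, \<open>\<beta> = 0\<close>
          suffices.\<close>
        show "deriv (T f) z = (deriv ^^ i) f (\<psi> z) * (m z - n z) - (deriv ^^ i) f (\<psi> z) * 0" if "fock_in p f" for f z
          using dT[OF that, of z] True by (simp add: right_diff_distrib)
        show "\<exists>\<alpha> \<beta>. cmod \<alpha> \<le> 1 \<and> cmod \<beta> \<le> 1 \<and>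
            cmod ((deriv ^^ i) (fock_test \<alpha> \<beta> (\<psi> z)) (\<psi> z)) = cmod (\<psi> z) ^ i * exp ((cmod (\<psi> z))\<^sup>2 / 2) \<and>
            (deriv ^^ i) (fock_test \<alpha> \<beta> (\<psi> z)) (\<psi> z) * 0 = 0" if "0 \<le> cmod z" for z
          using i cmod_fock_kernel[of "\<psi> z" "\<psi> z"]
          by (intro exI[of _ 1] exI[of _ 0], cases i) (auto simp: fock_test_def[of 1 0 "\<psi> z" "\<psi> z"] deriv_fock_test norm_mult)
      qed auto
      then show ?thesis using True by simp
    next
      case False
      obtain \<delta> R1 where \<delta>: "0 < \<delta>" and R1: "\<And>z. R1 \<le> cmod z \<Longrightarrow> \<delta> \<le> cmod (\<psi> z - \<theta> z)"
        using affine_separated False unfolding \<psi> \<theta> by blast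
      have R1': "\<delta> \<le> cmod (\<theta> z - \<psi> z)" if "R1 \<le> cmod z" for z
        using R1[OF that] by (simp add: norm_minus_commute)
      obtain R2 R3 where R2: "\<And>z. R2 \<le> cmod z \<Longrightarrow> 1 \<le> cmod (\<psi> z)" and R3: "\<And>z. R3 \<le> cmod z \<Longrightarrow> 1 \<le> cmod (\<theta> z)"
        using affine_large[OF a] affine_large[OF c] unfolding \<psi> \<theta> by metis
      have B: "0 \<le> 1 + 1/\<delta>" using \<delta> by simp
      have "(fock_symbol i m \<psi> \<longlongrightarrow> 0) at_infinity"
      proof (rule fock_symbol_tendsto_zero_if_compact[OF p q i a \<psi> TC Tin T0 dT B])
        show "\<exists>\<alpha> \<beta>. cmod \<alpha> \<le> 1 + 1/\<delta> \<and> cmod \<beta> \<le> 1 + 1/\<delta> \<and>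
            cmod ((deriv ^^ i) (fock_test \<alpha> \<beta> (\<psi> z)) (\<psi> z)) = cmod (\<psi> z) ^ i * exp ((cmod (\<psi> z))\<^sup>2 / 2) \<and>
            (deriv ^^ i) (fock_test \<alpha> \<beta> (\<psi> z)) (\<theta> z) * n z = 0" if "max R1 R2 \<le> cmod z" for z
          using fock_test_vanishing[OF R2[of z] \<delta> R1[of z] i] that by fastforce
      qed
      \<comment> \<open>Exchanging the branches negates both weights. The symbol sees only the
        modulus, so the sign disappears below.\<close>
      moreover have "(fock_symbol i (\<lambda>z. - n z) \<theta> \<longlongrightarrow> 0) at_infinity"
      proof (rule fock_symbol_tendsto_zero_if_compact[OF p q i c \<theta> TC Tin T0 _ B])
        show "deriv (T f) z = (deriv ^^ i) f (\<theta> z) * (- n z) - (deriv ^^ i) f (\<psi> z) * (- m z)" if "fock_in p f" for f z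
          using dT[OF that, of z] by simp
        show "\<exists>\<alpha> \<beta>. cmod \<alpha> \<le> 1 + 1/\<delta> \<and> cmod \<beta> \<le> 1 + 1/\<delta> \<and>
            cmod ((deriv ^^ i) (fock_test \<alpha> \<beta> (\<theta> z)) (\<theta> z)) = cmod (\<theta> z) ^ i * exp ((cmod (\<theta> z))\<^sup>2 / 2) \<and>
            (deriv ^^ i) (fock_test \<alpha> \<beta> (\<theta> z)) (\<psi> z) * (- m z) = 0" if "max R1 R3 \<le> cmod z" for z
          using fock_test_vanishing[OF R3[of z] \<delta> R1'[of z] i] that by fastforce
      qed
      then have "(fock_symbol i n \<theta> \<longlongrightarrow> 0) at_infinity"
        by (simp add: fock_symbol_def[abs_def])
      ultimately show ?thesis
        using fock_op_compact[OF p pq i a \<psi> m] fock_op_compact[OF p pq i c \<theta> n] by blast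
    qed
  next
    assume "(fock_compact_op p q (fock_op i m \<psi>) \<and> fock_compact_op p q (fock_op i n \<theta>)) \<or>
     (\<psi> = \<theta> \<and> (fock_symbol i (\<lambda>z. m z - n z) \<psi> \<longlongrightarrow> 0) at_infinity)"
    then show "fock_compact_op p q (\<lambda>f z. fock_op i m \<psi> f z - fock_op i n \<theta> f z)"
    proof
      assume "fock_compact_op p q (fock_op i m \<psi>) \<and> fock_compact_op p q (fock_op i n \<theta>)"
      then show ?thesis by (intro fock_compact_op_diff[OF q]) (use min nin in auto)
    next
      assume *: "\<psi> = \<theta> \<and> (fock_symbol i (\<lambda>z. m z - n z) \<psi> \<longlongrightarrow> 0) at_infinity"
      then have "fock_compact_op p q (fock_op i (\<lambda>z. m z - n z) \<psi>)"
        using fock_op_compact[OF p pq i a \<psi> mn] by blast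
      then show ?thesis
      proof (subst fock_compact_op_cong)
        show "(\<lambda>z. fock_op i m \<psi> f z - fock_op i n \<theta> f z) = fock_op i (\<lambda>z. m z - n z) \<psi> f" if "fock_in p f" for f
          using fock_op_weight_diff[OF m n \<psi>h fh[OF that]] * by (intro ext) simp
      qed
    qed
  qed
qed

theorem theorem4:
  fixes p q :: real and g1 \<psi>1 g2 \<psi>2 :: "complex \<Rightarrow> complex"
  assumes "0 < p" "p \<le> q"
    and "g1 holomorphic_on UNIV" "\<psi>1 holomorphic_on UNIV"
    and "g2 holomorphic_on UNIV" "\<psi>2 holomorphic_on UNIV"
    and "nonconstant g1" "nonconstant \<psi>1" "nonconstant g2" "nonconstant \<psi>2"
    and "fock_bounded_op p q (Vop g1 \<psi>1)" "fock_bounded_op p q (Vop g2 \<psi>2)"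
    and "fock_bounded_op p q (Jop g1 \<psi>1)" "fock_bounded_op p q (Jop g2 \<psi>2)"
  shows "(fock_compact_op p q (\<lambda>f z. Vop g1 \<psi>1 f z - Vop g2 \<psi>2 f z) \<longleftrightarrow>
            (fock_compact_op p q (Vop g1 \<psi>1) \<and> fock_compact_op p q (Vop g2 \<psi>2)) \<or>
            (\<psi>1 = \<psi>2 \<and> ((Mfun (\<lambda>z. g1 z - g2 z) \<psi>1) \<longlongrightarrow> 0) at_infinity))
       \<and> (fock_compact_op p q (\<lambda>f z. Jop g1 \<psi>1 f z - Jop g2 \<psi>2 f z) \<longleftrightarrow>
            (fock_compact_op p q (Jop g1 \<psi>1) \<and> fock_compact_op p q (Jop g2 \<psi>2)) \<or>
            (\<psi>1 = \<psi>2 \<and> ((Mtfun (\<lambda>z. g1 z - g2 z) \<psi>1) \<longlongrightarrow> 0) at_infinity))"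
proof -
  have q: "0 < q" using assms(1,2) by simp
  \<comment> \<open>The operators \<open>Vop\<close> and \<open>Jop\<close> share their inner maps,
    so affineness obtained from \<open>Vop\<close> serves both parts.\<close>
  obtain a b where ab: "a \<noteq> 0" "\<psi>1 = (\<lambda>z. a * z + b)"
    using Vop_bounded_imp_affine[OF assms(1) q assms(3,4,7,8,11)] by blast
  obtain c d where cd: "c \<noteq> 0" "\<psi>2 = (\<lambda>z. c * z + d)"
    using Vop_bounded_imp_affine[OF assms(1) q assms(5,6,9,10,12)] by blast
  have dg: "deriv g1 holomorphic_on UNIV" "deriv g2 holomorphic_on UNIV"
    using assms(3,5) by (simp_all add: holomorphic_deriv)
  have dd: "deriv (\<lambda>z. g1 z - g2 z) = (\<lambda>z. deriv g1 z - deriv g2 z)"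
    using deriv_funpow_diff[OF assms(3,5), of 1] by (intro ext) simp
  show ?thesis
    using fock_op_diff_compact_iff[OF assms(1,2) _ dg ab cd, of 0]
      fock_op_diff_compact_iff[OF assms(1,2) _ assms(3,5) ab cd, of 1] assms(11-14)
    unfolding Vop_eq_fock_op Jop_eq_fock_op Mfun_eq_fock_symbol Mtfun_eq_fock_symbol dd
    by simp
qed

end
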